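(* Let $m\ge2$, let $\varepsilon\in\mathbb{R}$, and let $\mathfrak{M}_\varepsilon:=(\mathbb{R}^m,A)$, where the non-zero components of $A$ are determined by $$A_{ijj}{}^i=1\text{ for }1\le i\ne j\le m\quad\text{ and }\quad A_{122}{}^2=A_{121}{}^1=-\varepsilon.$$ Then: (1) $\mathfrak{M}_\varepsilon$ is an affine projective Osserman curvature model for any $\varepsilon$. (2) $\mathfrak{M}_\varepsilon$ is geometrically realizable by an affine projective Osserman manifold.
   Context: An affine curvature model $(V,A)$ is a finite-dimensional real vector space $V$ with a bilinear map $A:V\times V\to\operatorname{End}(V)$ such that $A(x,y)z=-A(y,x)z$ and $A(x,y)z+A(y,z)x+A(z,x)y=0$ for all $x,y,z\in V$. Here $\{e_1,\dots,e_m\}$ is the standard basis of $\mathbb{R}^m$ and components are defined by $A(e_i,e_j)e_k=\sum_l A_{ijk}{}^l e_l$. "Determined by" means that all components are zero except those listed and those obtained from them by the antisymmetry $A_{jik}{}^l=-A_{ijk}{}^l$. The Jacobi operator is $\mathcal{J}(v)w:=A(w,v)v$. For a linear map $T$ of a finite-dimensional real vector space, $\operatorname{Spec}\{T\}\subset\mathbb{C}$ is the set of complex roots of its characteristic polynomial. $(V,A)$ is an affine projective Osserman curvature model if for all non-zero $v,w\in V$ there is a real $s(v,w)\ne0$ with $\operatorname{Spec}\{\mathcal{J}(v)\}=s(v,w)\cdot\operatorname{Spec}\{\mathcal{J}(w)\}\ne\{0\}$. An affine manifold $(M,\nabla)$ is a smooth manifold with a torsion-free connection; $R(x,y)=\nabla_x\nabla_y-\nabla_y\nabla_x-\nabla_{[x,y]}$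 is its curvature operator and $\mathcal{J}(x):y\mapsto R(y,x)x$ its Jacobi operator. $(M,\nabla)$ is an affine projective Osserman manifold if for any pair of non-zero tangent vectors $x,y\in TM$ (possibly with different base points) there is a real $s(x,y)\ne0$ with $\operatorname{Spec}\{\mathcal{J}(y)\}=s(x,y)\cdot\operatorname{Spec}\{\mathcal{J}(x)\}\ne\{0\}$. An affine curvature model $(V,A)$ is geometrically realizable by $(M,\nabla)$ if there is a point $P\in M$ such that $(V,A)$ is isomorphic to $(T_PM,R_P)$, i.e. there is a linear isomorphism $V\to T_PM$ carrying $A$ to $R_P$. *)

theory Defs
  imports
    "HOL-Analysis.Analysis"
    "HOL-Library.Function_Algebras"
    "Jordan_Normal_Form.Char_Poly"
begin

no_notation Matrix.vec_index (infixl \<open>$\<close> 100)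

text \<open>
  Tangent vectors are functionals on smooth functions and vector fields are families of
  these. The pointwise operations make both function types real vector spaces, so that the
  library notions (subspace, span, independent, representation, linear) apply to tangent spaces.
\<close>

instantiation "fun" :: (type, scaleR) scaleR
begin

definition scaleR_fun :: "real \<Rightarrow> ('a \<Rightarrow> 'b) \<Rightarrow> 'a \<Rightarrow> 'b"
  where "scaleR_fun c f = (\<lambda>x. c *\<^sub>R f x)"

instance ..

end

instance "fun" :: (type, real_vector) real_vector
  by standard (simp_all add: scaleR_fun_def fun_eq_iff scaleR_add_right scaleR_add_left)


section \<open>Spectra\<close>

text \<open>Finite-dimensional vector spaces are subspaces of an ambient type, so that \<open>\<real>\<^sup>m\<close> and
  tangent spaces are treated uniformly.\<close>

definition finite_dim_space :: "'v::real_vector set \<Rightarrow> bool"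
  where "finite_dim_space V \<longleftrightarrow> subspace V \<and> (\<exists>B. finite B \<and> V = span B)"

definition ordered_basis :: "'v::real_vector set \<Rightarrow> 'v list \<Rightarrow> bool"
  where "ordered_basis V bs \<longleftrightarrow> distinct bs \<and> independent (set bs) \<and> span (set bs) = V"

definition matrix_wrt :: "'v::real_vector list \<Rightarrow> ('v \<Rightarrow> 'v) \<Rightarrow> real Matrix.mat"
  where "matrix_wrt bs T =
    Matrix.mat (length bs) (length bs) (\<lambda>(i, j). representation (set bs) (T (bs ! j)) (bs ! i))"

text \<open>The choice of the basis is immaterial, as similar matrices have equal characteristic
  polynomials.\<close>

definition char_polynomial :: "'v::real_vector set \<Rightarrow> ('v \<Rightarrow> 'v) \<Rightarrow> real poly"
  where "char_polynomial V T = char_poly (matrix_wrt (SOME bs. ordered_basis V bs) T)"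

definition Spec :: "'v::real_vector set \<Rightarrow> ('v \<Rightarrow> 'v) \<Rightarrow> complex set"
  where "Spec V T = {z. poly (map_poly complex_of_real (char_polynomial V T)) z = 0}"


section \<open>Affine curvature models\<close>

definition linear_within :: "'v::real_vector set \<Rightarrow> ('v \<Rightarrow> 'v) \<Rightarrow> bool"
  where "linear_within V T \<longleftrightarrow>
    (\<forall>x\<in>V. T x \<in> V) \<and> (\<forall>x\<in>V. \<forall>y\<in>V. T (x + y) = T x + T y) \<and>
    (\<forall>c. \<forall>x\<in>V. T (c *\<^sub>R x) = c *\<^sub>R T x)"

definition affine_curvature_model ::
    "'v::real_vector set \<Rightarrow> ('v \<Rightarrow> 'v \<Rightarrow> 'v \<Rightarrow> 'v) \<Rightarrow> bool"
  where "affine_curvature_model V A \<longleftrightarrow>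
    finite_dim_space V \<and>
    (\<forall>y\<in>V. \<forall>z\<in>V. linear_within V (\<lambda>x. A x y z)) \<and>
    (\<forall>x\<in>V. \<forall>z\<in>V. linear_within V (\<lambda>y. A x y z)) \<and>
    (\<forall>x\<in>V. \<forall>y\<in>V. linear_within V (\<lambda>z. A x y z)) \<and>
    (\<forall>x\<in>V. \<forall>y\<in>V. \<forall>z\<in>V. A x y z = - A y x z) \<and>
    (\<forall>x\<in>V. \<forall>y\<in>V. \<forall>z\<in>V. A x y z + A y z x + A z x y = 0)"

definition jacobi_operator :: "('v \<Rightarrow> 'v \<Rightarrow> 'v \<Rightarrow> 'v) \<Rightarrow> 'v \<Rightarrow> 'v \<Rightarrow> 'v"
  where "jacobi_operator A v = (\<lambda>w. A w v v)"

definition affine_projective_Osserman_model ::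
    "'v::real_vector set \<Rightarrow> ('v \<Rightarrow> 'v \<Rightarrow> 'v \<Rightarrow> 'v) \<Rightarrow> bool"
  where "affine_projective_Osserman_model V A \<longleftrightarrow>
    affine_curvature_model V A \<and>
    (\<forall>v\<in>V - {0}. \<forall>w\<in>V - {0}. \<exists>s::real. s \<noteq> 0 \<and>
      Spec V (jacobi_operator A v) = (\<lambda>z. complex_of_real s * z) ` Spec V (jacobi_operator A w) \<and>
      (\<lambda>z. complex_of_real s * z) ` Spec V (jacobi_operator A w) \<noteq> {0})"

text \<open>A linear map between subspaces extends to the ambient types, so requiring global
  linearity of \<open>L\<close> is no restriction.\<close>

definition isomorphic_models ::
    "'v::real_vector set \<Rightarrow> ('v \<Rightarrow> 'v \<Rightarrow> 'v \<Rightarrow> 'v) \<Rightarrow>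
     'w::real_vector set \<Rightarrow> ('w \<Rightarrow> 'w \<Rightarrow> 'w \<Rightarrow> 'w) \<Rightarrow> bool"
  where "isomorphic_models V A W B \<longleftrightarrow>
    (\<exists>L. linear L \<and> bij_betw L V W \<and>
      (\<forall>x\<in>V. \<forall>y\<in>V. \<forall>z\<in>V. L (A x y z) = B (L x) (L y) (L z)))"


section \<open>Smooth manifolds\<close>

primrec Ck_on :: "nat \<Rightarrow> 'e::euclidean_space set \<Rightarrow> ('e \<Rightarrow> 'f::real_normed_vector) \<Rightarrow> bool"
  where
    "Ck_on 0 S f \<longleftrightarrow> continuous_on S f"
  | "Ck_on (Suc k) S f \<longleftrightarrow>
      (\<forall>x\<in>S. f differentiable (at x)) \<and> (\<forall>u. Ck_on k S (\<lambda>x. frechet_derivative f (at x) u))"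

definition smooth_on :: "'e::euclidean_space set \<Rightarrow> ('e \<Rightarrow> 'f::real_normed_vector) \<Rightarrow> bool"
  where "smooth_on S f \<longleftrightarrow> (\<forall>k. Ck_on k S f)"

text \<open>\<open>Ck_on\<close> and \<open>smooth_on\<close> are only meaningful on open sets \<open>S\<close>. A chart is a pair of its domain and the coordinate map; the coordinate map is only
  relevant on the domain. Atlases need not be maximal.\<close>

type_synonym ('a, 'e) chart = "'a set \<times> ('a \<Rightarrow> 'e)"

definition smooth_atlas :: "'a topology \<Rightarrow> ('a, 'e::euclidean_space) chart set \<Rightarrow> bool"
  where "smooth_atlas M \<A> \<longleftrightarrow>
    (\<Union>(U, \<phi>)\<in>\<A>. U) = topspace M \<and>
    (\<forall>(U, \<phi>)\<in>\<A>. openin M U \<and> open (\<phi> ` U) \<and>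
      homeomorphic_map (subtopology M U) (top_of_set (\<phi> ` U)) \<phi>) \<and>
    (\<forall>(U, \<phi>)\<in>\<A>. \<forall>(V, \<psi>)\<in>\<A>. smooth_on (\<phi> ` (U \<inter> V)) (\<psi> \<circ> inv_into U \<phi>))"

definition smooth_manifold :: "'a topology \<Rightarrow> ('a, 'e::euclidean_space) chart set \<Rightarrow> bool"
  where "smooth_manifold M \<A> \<longleftrightarrow> Hausdorff_space M \<and> second_countable M \<and> smooth_atlas M \<A>"

text \<open>Functions, tangent vectors and vector fields are normalised to be 0 outside their
  mathematical domains, so that equality has its usual meaning.\<close>

definition smooth_functions :: "'a topology \<Rightarrow> ('a, 'e::euclidean_space) chart set \<Rightarrow> ('a \<Rightarrow> real) set"
  where "smooth_functions M \<A> =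
    {f. (\<forall>p. p \<notin> topspace M \<longrightarrow> f p = 0) \<and> (\<forall>(U, \<phi>)\<in>\<A>. smooth_on (\<phi> ` U) (f \<circ> inv_into U \<phi>))}"

type_synonym 'a tangent = "('a \<Rightarrow> real) \<Rightarrow> real"

text \<open>The derivation \<open>\<Sum>\<^sub>i u\<^sub>i \<partial>/\<partial>x\<^sub>i\<close> at \<open>p\<close> in the coordinates of a chart around \<open>p\<close>.\<close>

definition coordinate_derivation ::
    "'a topology \<Rightarrow> ('a, 'e::euclidean_space) chart set \<Rightarrow> ('a, 'e) chart \<Rightarrow> 'a \<Rightarrow> 'e \<Rightarrow> 'a tangent"
  where "coordinate_derivation M \<A> = (\<lambda>(U, \<phi>) p u f.
    if f \<in> smooth_functions M \<A> then frechet_derivative (f \<circ> inv_into U \<phi>) (at (\<phi> p)) u else 0)"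

definition tangent_space ::
    "'a topology \<Rightarrow> ('a, 'e::euclidean_space) chart set \<Rightarrow> 'a \<Rightarrow> 'a tangent set"
  where "tangent_space M \<A> p =
    {coordinate_derivation M \<A> c p u |c u. c \<in> \<A> \<and> p \<in> fst c}"

type_synonym 'a vector_field = "'a \<Rightarrow> 'a tangent"

definition vector_fields ::
    "'a topology \<Rightarrow> ('a, 'e::euclidean_space) chart set \<Rightarrow> 'a vector_field set"
  where "vector_fields M \<A> =
    {X. (\<forall>p\<in>topspace M. X p \<in> tangent_space M \<A> p) \<and> (\<forall>p. p \<notin> topspace M \<longrightarrow> X p = 0) \<and>
        (\<forall>f\<in>smooth_functions M \<A>. (\<lambda>p. X p f) \<in> smooth_functions M \<A>)}"

definition fscale :: "('a \<Rightarrow> real) \<Rightarrow> 'a vector_field \<Rightarrow> 'a vector_field"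
  where "fscale f X = (\<lambda>p. f p *\<^sub>R X p)"

definition lie_bracket :: "'a vector_field \<Rightarrow> 'a vector_field \<Rightarrow> 'a vector_field"
  where "lie_bracket X Y = (\<lambda>p f. X p (\<lambda>q. Y q f) - Y p (\<lambda>q. X q f))"


section \<open>Affine manifolds\<close>

type_synonym 'a connection = "'a vector_field \<Rightarrow> 'a vector_field \<Rightarrow> 'a vector_field"

definition is_connection ::
    "'a topology \<Rightarrow> ('a, 'e::euclidean_space) chart set \<Rightarrow> 'a connection \<Rightarrow> bool"
  where "is_connection M \<A> D \<longleftrightarrow>
    (\<forall>X\<in>vector_fields M \<A>. \<forall>Y\<in>vector_fields M \<A>. D X Y \<in> vector_fields M \<A>) \<and>
    (\<forall>X\<in>vector_fields M \<A>. \<forall>X'\<in>vector_fields M \<A>. \<forall>Y\<in>vector_fields M \<A>.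
      D (X + X') Y = D X Y + D X' Y) \<and>
    (\<forall>f\<in>smooth_functions M \<A>. \<forall>X\<in>vector_fields M \<A>. \<forall>Y\<in>vector_fields M \<A>.
      D (fscale f X) Y = fscale f (D X Y)) \<and>
    (\<forall>X\<in>vector_fields M \<A>. \<forall>Y\<in>vector_fields M \<A>. \<forall>Y'\<in>vector_fields M \<A>.
      D X (Y + Y') = D X Y + D X Y') \<and>
    (\<forall>f\<in>smooth_functions M \<A>. \<forall>X\<in>vector_fields M \<A>. \<forall>Y\<in>vector_fields M \<A>.
      D X (fscale f Y) = fscale (\<lambda>p. X p f) Y + fscale f (D X Y))"

definition torsion_free ::
    "'a topology \<Rightarrow> ('a, 'e::euclidean_space) chart set \<Rightarrow> 'a connection \<Rightarrow> bool"
  where "torsion_free M \<A> D \<longleftrightarrow>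
    (\<forall>X\<in>vector_fields M \<A>. \<forall>Y\<in>vector_fields M \<A>. D X Y - D Y X = lie_bracket X Y)"

definition affine_manifold ::
    "'a topology \<Rightarrow> ('a, 'e::euclidean_space) chart set \<Rightarrow> 'a connection \<Rightarrow> bool"
  where "affine_manifold M \<A> D \<longleftrightarrow>
    smooth_manifold M \<A> \<and> is_connection M \<A> D \<and> torsion_free M \<A> D"

definition curvature :: "'a connection \<Rightarrow> 'a vector_field \<Rightarrow> 'a vector_field \<Rightarrow> 'a vector_field \<Rightarrow>
     'a vector_field"
  where "curvature D X Y Z = D X (D Y Z) - D Y (D X Z) - D (lie_bracket X Y) Z"

text \<open>The curvature is a tensor and tangent vectors extend to global vector fields: its value at \<open>p\<close> does not depend on the vector fields
  extending \<open>x\<close>, \<open>y\<close> and \<open>z\<close>.\<close>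

definition curvature_at ::
    "'a topology \<Rightarrow> ('a, 'e::euclidean_space) chart set \<Rightarrow> 'a connection \<Rightarrow> 'a \<Rightarrow>
     'a tangent \<Rightarrow> 'a tangent \<Rightarrow> 'a tangent \<Rightarrow> 'a tangent"
  where "curvature_at M \<A> D p x y z =
    (THE w. \<exists>X\<in>vector_fields M \<A>. \<exists>Y\<in>vector_fields M \<A>. \<exists>Z\<in>vector_fields M \<A>.
      X p = x \<and> Y p = y \<and> Z p = z \<and> w = curvature D X Y Z p)"

definition affine_projective_Osserman_manifold ::
    "'a topology \<Rightarrow> ('a, 'e::euclidean_space) chart set \<Rightarrow> 'a connection \<Rightarrow> bool"
  where "affine_projective_Osserman_manifold M \<A> D \<longleftrightarrow>
    affine_manifold M \<A> D \<and>
    (\<forall>p\<in>topspace M. \<forall>q\<in>topspace M.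
      \<forall>x\<in>tangent_space M \<A> p - {0}. \<forall>y\<in>tangent_space M \<A> q - {0}.
      let Sx = Spec (tangent_space M \<A> p) (jacobi_operator (curvature_at M \<A> D p) x);
          Sy = Spec (tangent_space M \<A> q) (jacobi_operator (curvature_at M \<A> D q) y)
      in \<exists>s::real. s \<noteq> 0 \<and> Sy = (\<lambda>z. complex_of_real s * z) ` Sx \<and>
           (\<lambda>z. complex_of_real s * z) ` Sx \<noteq> {0})"

definition geometrically_realizable_by ::
    "'v::real_vector set \<Rightarrow> ('v \<Rightarrow> 'v \<Rightarrow> 'v \<Rightarrow> 'v) \<Rightarrow>
     'a topology \<Rightarrow> ('a, 'e::euclidean_space) chart set \<Rightarrow> 'a connection \<Rightarrow> bool"
  where "geometrically_realizable_by V A M \<A> D \<longleftrightarrow>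
    (\<exists>p\<in>topspace M. isomorphic_models V A (tangent_space M \<A> p) (curvature_at M \<A> D p))"


section \<open>The model\<close>

text \<open>The component \<open>A\<^sub>i\<^sub>j\<^sub>k\<^sup>l\<close>, for \<open>i, j, k, l\<close> in \<open>{1..m}\<close>. The second and fourth cases are
  those obtained from the first and third by antisymmetry in \<open>i\<close> and \<open>j\<close>.\<close>

definition model_component :: "real \<Rightarrow> nat \<Rightarrow> nat \<Rightarrow> nat \<Rightarrow> nat \<Rightarrow> real"
  where "model_component \<epsilon> i j k l =
    (if i \<noteq> j \<and> k = j \<and> l = i then 1
     else if i \<noteq> j \<and> k = i \<and> l = j then - 1
     else if (i, j, k, l) \<in> {(1, 2, 2, 2), (1, 2, 1, 1)} then - \<epsilon>
     else if (i, j, k, l) \<in> {(2, 1, 2, 2), (2, 1, 1, 1)} then \<epsilon>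
     else 0)"

text \<open>The enumeration \<open>idx\<close> numbers the coordinates of \<open>real ^ 'm\<close> from 1 to \<open>m\<close>.\<close>

definition basis_vector :: "(nat \<Rightarrow> 'm::finite) \<Rightarrow> nat \<Rightarrow> real ^ 'm"
  where "basis_vector idx i = axis (idx i) 1"

definition model_curvature ::
    "(nat \<Rightarrow> 'm::finite) \<Rightarrow> real \<Rightarrow> real ^ 'm \<Rightarrow> real ^ 'm \<Rightarrow> real ^ 'm \<Rightarrow> real ^ 'm"
  where "model_curvature idx \<epsilon> x y z =
    (\<Sum>i = 1..CARD('m). \<Sum>j = 1..CARD('m). \<Sum>k = 1..CARD('m). \<Sum>l = 1..CARD('m).
      (x $ idx i * y $ idx j * z $ idx k * model_component \<epsilon> i j k l) *\<^sub>R basis_vector idx l)"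

end

theory Submission
  imports Defs
begin

text \<open>
Write \<open>a\<close> and \<open>b\<close> for the first two coordinates and \<open>Q\<close> for the projection to the plane that
  they span. For a positive definite symmetric bilinear form \<open>h\<close> consider the tensor

  \<open>A(u,v)w = h(v,w)u - h(u,w)v - \<epsilon> (u\<^sub>a v\<^sub>b - u\<^sub>b v\<^sub>a) Qw.\<close>

  The model is the case in which \<open>h\<close> is the Euclidean inner product
  (\<open>model_curvature_eq_osserman_tensor\<close>). Let \<open>J\<close> be the Jacobi operator of \<open>v \<noteq> 0\<close> and
  \<open>l = h(v,v) > 0\<close>. Then \<open>J v = 0\<close>, every \<open>(J - l) u\<close> is a combination of \<open>v\<close> and \<open>Qv\<close>, and
  \<open>(J - l) Qv\<close> is a multiple of \<open>v\<close>. So \<open>(J - l)\<^sup>2\<close> maps everything to multiples of \<open>v\<close>. It follows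
  that \<open>J (J - l)\<^sup>2 = 0\<close>, which leaves only \<open>0\<close> and \<open>l\<close> as eigenvalues, and that \<open>(J - l)\<^sup>2\<close> has a
  non-trivial kernel in dimension at least 2, so that \<open>l\<close> does occur. The spectrum therefore is \<open>{0, h(v,v)}\<close>,
  whatever \<open>\<epsilon>\<close> is, and any two such sets are proportional (\<open>Spec_jacobi_osserman\<close>).

  The same computation handles a manifold whose curvature has this form at every point, where \<open>h\<close>
  and \<open>\<epsilon>\<close> may depend on the point. Such a connection on all of \<open>\<real>\<^sup>m\<close> is

  \<open>\<Gamma>(u,v) = \<alpha>(u)v + \<alpha>(v)u + S(u,v).\<close>

  Here \<open>S\<close> belongs to the coordinate plane of \<open>a\<close> and \<open>b\<close> and is the classical normal form of a
  surface connection with skew-symmetric Ricci tensor: \<open>\<nabla>\<^sub>a \<partial>\<^sub>a = - (\<partial>\<^sub>a \<phi>) \<partial>\<^sub>a\<close>,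
  \<open>\<nabla>\<^sub>b \<partial>\<^sub>b = (\<partial>\<^sub>b \<phi>) \<partial>\<^sub>b\<close>, and zero otherwise. Its curvature is
  \<open>\<partial>\<^sub>a \<partial>\<^sub>b \<phi> (u\<^sub>a v\<^sub>b - u\<^sub>b v\<^sub>a) Qw\<close>. The closed one-form \<open>\<alpha>\<close> is a projective change; it adds the terms
  with \<open>h(v,w) = - (D\<^sub>v \<alpha>)(w) + \<alpha>(v) \<alpha>(w) + \<alpha>(S(v,w))\<close> (\<open>curv_osserman_symbols\<close>). What remains is to keep
  \<open>h\<close> positive definite on the whole space in spite of the last term, which has no sign. The choice
  \<open>\<phi> = - \<epsilon> sin x\<^sub>a sin x\<^sub>b\<close> bounds the coefficients of \<open>S\<close> by \<open>\<bar>\<epsilon>\<bar>\<close>, and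
  \<open>\<alpha> = - \<Sum>\<^sub>i sinh (\<kappa> x\<^sub>i) / \<kappa> dx\<^sub>i\<close> with \<open>\<kappa> \<ge> \<bar>\<epsilon>\<bar>\<close> grows in such a way that the term
  \<open>cosh (\<kappa> x\<^sub>i)\<close> of \<open>- D\<alpha>\<close> always beats the \<open>sinh (\<kappa> x\<^sub>i)\<close> of \<open>\<alpha>\<close> (\<open>pos_def_osserman_form\<close>). At the
  origin \<open>\<alpha>\<close> and \<open>S\<close> vanish, \<open>h\<close> is the inner product and the coefficient of \<open>Qw\<close> is that of the model,
  so the tangent space at the origin realizes it.

  Two facts have to be supplied along the way. Spectra are defined by a characteristic polynomial in
  some basis; \<open>Spec_iff\<close> describes them by eigenvectors in the complexification, independently
  of a basis, and so transports them to tangent spaces. And the Lie bracket is only a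
  vector field because second derivatives commute (\<open>dir_deriv_commute\<close>).
\<close>

section \<open>Smooth real functions on a Euclidean space\<close>

definition dir_deriv :: "'e::euclidean_space \<Rightarrow> ('e \<Rightarrow> real) \<Rightarrow> 'e \<Rightarrow> real"
  where "dir_deriv u f = (\<lambda>p. frechet_derivative f (at p) u)"

lemma has_derivative_dir_deriv:
  "f differentiable (at p) \<Longrightarrow> (f has_derivative (\<lambda>u. dir_deriv u f p)) (at p)"
  by (simp add: dir_deriv_def frechet_derivative_works)

lemma dir_deriv_eqI: "(f has_derivative f') (at p) \<Longrightarrow> dir_deriv u f p = f' u"
  unfolding dir_deriv_def by (metis frechet_derivative_at)

lemma dir_deriv_linear:
  assumes "f differentiable (at p)"
  shows "linear (\<lambda>u. dir_deriv u f p)"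
  using has_derivative_linear[OF has_derivative_dir_deriv[OF assms]] .

lemma dir_deriv_const [simp]: "dir_deriv u (\<lambda>p. c) = (\<lambda>p. 0)"
  by (simp add: dir_deriv_def)

lemma dir_deriv_add:
  assumes "f differentiable (at p)" "g differentiable (at p)"
  shows "dir_deriv u (\<lambda>x. f x + g x) p = dir_deriv u f p + dir_deriv u g p"
  by (rule dir_deriv_eqI[OF has_derivative_add[OF assms[THEN has_derivative_dir_deriv]]])

lemma dir_deriv_mult:
  assumes "f differentiable (at p)" "g differentiable (at p)"
  shows "dir_deriv u (\<lambda>x. f x * g x) p = f p * dir_deriv u g p + dir_deriv u f p * g p"
  by (rule dir_deriv_eqI[OF has_derivative_mult[OF assms[THEN has_derivative_dir_deriv]]])

lemma dir_deriv_sum: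
  assumes "\<And>i. i \<in> I \<Longrightarrow> f i differentiable (at p)"
  shows "dir_deriv u (\<lambda>x. \<Sum>i\<in>I. f i x) p = (\<Sum>i\<in>I. dir_deriv u (f i) p)"
  by (rule dir_deriv_eqI) (intro has_derivative_sum has_derivative_dir_deriv assms)

lemma dir_deriv_component [simp]: "dir_deriv u (\<lambda>x. x $ i) p = u $ i"
  by (rule dir_deriv_eqI) (intro derivative_eq_intros bounded_linear_imp_has_derivative bounded_linear_vec_nth)

lemma Ck_on_Suc_dir_deriv:
  "Ck_on (Suc k) UNIV f \<longleftrightarrow> (\<forall>x. f differentiable (at x)) \<and> (\<forall>u. Ck_on k UNIV (dir_deriv u f))"
  by (simp add: dir_deriv_def)

lemma Ck_on_Suc_imp_Ck_on: "Ck_on (Suc k) UNIV (f :: 'e::euclidean_space \<Rightarrow> real) \<Longrightarrow> Ck_on k UNIV f"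
proof (induction k arbitrary: f)
  case 0
  then show ?case
    by (auto intro!: differentiable_imp_continuous_on simp: differentiable_on_def)
next
  case (Suc k)
  then show ?case
    unfolding Ck_on_Suc_dir_deriv[of "Suc k"] Ck_on_Suc_dir_deriv[of k] by blast
qed

lemma Ck_on_const: "Ck_on k UNIV (\<lambda>x::'e::euclidean_space. c :: real)"
proof (induction k arbitrary: c)
  case (Suc k)
  then show ?case unfolding Ck_on_Suc_dir_deriv by simp
qed simp

lemma Ck_on_add:
  fixes f g :: "'e::euclidean_space \<Rightarrow> real"
  shows "Ck_on k UNIV f \<Longrightarrow> Ck_on k UNIV g \<Longrightarrow> Ck_on k UNIV (\<lambda>x. f x + g x)"
proof (induction k arbitrary: f g)
  case 0
  then show ?case by (auto intro: continuous_on_add)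
next
  case (Suc k)
  then have d: "\<And>x. f differentiable (at x)" "\<And>x. g differentiable (at x)"
    by auto
  then have "dir_deriv u (\<lambda>x. f x + g x) = (\<lambda>x. dir_deriv u f x + dir_deriv u g x)" for u
    by (simp add: fun_eq_iff dir_deriv_add)
  with Suc d show ?case
    unfolding Ck_on_Suc_dir_deriv by auto
qed

lemma Ck_on_mult:
  fixes f g :: "'e::euclidean_space \<Rightarrow> real"
  shows "Ck_on k UNIV f \<Longrightarrow> Ck_on k UNIV g \<Longrightarrow> Ck_on k UNIV (\<lambda>x. f x * g x)"
proof (induction k arbitrary: f g)
  case 0
  then show ?case by (auto intro: continuous_on_mult)
next
  case (Suc k)
  then have d: "\<And>x. f differentiable (at x)" "\<And>x. g differentiable (at x)"
    by auto
  then have "dir_deriv u (\<lambda>x. f x * g x) = (\<lambda>x. f x * dir_deriv u g x + dir_deriv u f x * g x)" for u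
    by (simp add: fun_eq_iff dir_deriv_mult)
  moreover have "Ck_on k UNIV f" "Ck_on k UNIV g"
    using Suc.prems by (blast intro: Ck_on_Suc_imp_Ck_on)+
  ultimately show ?case
    using Suc d unfolding Ck_on_Suc_dir_deriv by (auto intro!: Ck_on_add)
qed

lemma smooth_differentiable: "smooth_on UNIV f \<Longrightarrow> f differentiable (at x)"
  unfolding smooth_on_def by (drule spec[of _ "Suc 0"]) simp

lemma smooth_dir_deriv: "smooth_on UNIV f \<Longrightarrow> smooth_on UNIV (dir_deriv u f)"
  unfolding smooth_on_def by (metis Ck_on_Suc_dir_deriv)

lemma smooth_continuous: "smooth_on UNIV f \<Longrightarrow> continuous_on UNIV f"
  unfolding smooth_on_def by (metis Ck_on.simps(1))

lemma smooth_const [simp, intro]: "smooth_on UNIV (\<lambda>x::'e::euclidean_space. c :: real)"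
  by (simp add: smooth_on_def Ck_on_const)

lemma smooth_add [intro]:
  fixes f g :: "'e::euclidean_space \<Rightarrow> real"
  shows "smooth_on UNIV f \<Longrightarrow> smooth_on UNIV g \<Longrightarrow> smooth_on UNIV (\<lambda>x. f x + g x)"
  by (simp add: smooth_on_def Ck_on_add)

lemma smooth_mult [intro]:
  fixes f g :: "'e::euclidean_space \<Rightarrow> real"
  shows "smooth_on UNIV f \<Longrightarrow> smooth_on UNIV g \<Longrightarrow> smooth_on UNIV (\<lambda>x. f x * g x)"
  by (simp add: smooth_on_def Ck_on_mult)

lemma smooth_diff [intro]:
  fixes f g :: "'e::euclidean_space \<Rightarrow> real"
  shows "smooth_on UNIV f \<Longrightarrow> smooth_on UNIV g \<Longrightarrow> smooth_on UNIV (\<lambda>x. f x - g x)"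
  using smooth_add[of f "\<lambda>x. (-1) * g x"] smooth_mult[of "\<lambda>x. -1" g] by simp

lemma smooth_sum [intro]:
  fixes f :: "'i \<Rightarrow> 'e::euclidean_space \<Rightarrow> real"
  shows "(\<And>i. i \<in> I \<Longrightarrow> smooth_on UNIV (f i)) \<Longrightarrow> smooth_on UNIV (\<lambda>x. \<Sum>i\<in>I. f i x)"
proof (induction I rule: infinite_finite_induct)
  case (insert i I)
  then show ?case by (simp add: smooth_add)
qed simp_all

lemma smooth_component [intro]: "smooth_on UNIV (\<lambda>x::real^'m. x $ i)"
  unfolding smooth_on_def
proof
  fix k
  have "Ck_on (Suc k) UNIV (\<lambda>x::real^'m. x $ i)"
    unfolding Ck_on_Suc_dir_deriv
  proof safe
    fix u :: "real^'m"
    have "dir_deriv u (\<lambda>x. x $ i) = (\<lambda>p. u $ i)" by (simp add: fun_eq_iff)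
    then show "Ck_on k UNIV (dir_deriv u (\<lambda>x. x $ i))" by (simp add: Ck_on_const)
  next
    show "(\<lambda>x. x $ i) differentiable at x" for x :: "real^'m"
      by (rule bounded_linear_imp_differentiable[OF bounded_linear_vec_nth])
  qed
  then show "Ck_on k UNIV (\<lambda>x::real^'m. x $ i)" by (rule Ck_on_Suc_imp_Ck_on)
qed

lemma has_derivative_comp_component:
  assumes "(g has_real_derivative d) (at (p $ i))"
  shows "((\<lambda>x::real^'m. g (x $ i)) has_derivative (\<lambda>u. d * u $ i)) (at p)"
proof -
  have "((\<lambda>x::real^'m. x $ i) has_derivative (\<lambda>u. u $ i)) (at p)"
    by (intro bounded_linear_imp_has_derivative bounded_linear_vec_nth)
  from has_derivative_compose[OF this has_field_derivative_imp_has_derivative[OF assms]]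
  show ?thesis by simp
qed

text \<open>Membership in a set of functions that is closed under differentiation up to constant factors is an
  invariant that survives every derivative; \<open>{sin, cos}\<close> and \<open>{sinh, cosh}\<close> are such sets.\<close>

lemma smooth_comp_component:
  assumes F: "\<And>g. g \<in> F \<Longrightarrow> \<exists>h\<in>F. \<exists>c. \<forall>t. (g has_real_derivative c * h t) (at t)"
    and "g \<in> F"
  shows "smooth_on UNIV (\<lambda>x::real^'m. g (x $ i))"
proof -
  have "Ck_on k UNIV (\<lambda>x::real^'m. g (x $ i))" if "g \<in> F" for k g
    using that
  proof (induction k arbitrary: g)
    case 0
    with F obtain h c where "\<forall>t. (g has_real_derivative c * h t) (at t)" by meson
    then have "(\<lambda>x::real^'m. g (x $ i)) differentiable (at x)" for x
      using has_derivative_comp_component differentiableI by metis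
    then show ?case
      by (auto intro!: differentiable_imp_continuous_on simp: differentiable_on_def)
  next
    case (Suc k)
    with F obtain h c where h: "h \<in> F" "\<forall>t. (g has_real_derivative c * h t) (at t)" by meson
    then have d: "((\<lambda>x::real^'m. g (x $ i)) has_derivative (\<lambda>u. c * h (x $ i) * u $ i)) (at x)" for x
      using has_derivative_comp_component by blast
    then have "dir_deriv u (\<lambda>x::real^'m. g (x $ i)) = (\<lambda>x. c * h (x $ i) * u $ i)" for u
      by (auto simp: fun_eq_iff dest: dir_deriv_eqI)
    then show ?case
      using d Suc.IH[OF h(1)] unfolding Ck_on_Suc_dir_deriv
      by (auto intro!: differentiableI Ck_on_mult Ck_on_const)
  qed
  then show ?thesis using assms(2) by (simp add: smooth_on_def)
qed

lemma smooth_sin_component [intro]: "smooth_on UNIV (\<lambda>x::real^'m. sin (x $ i))"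
  and smooth_cos_component [intro]: "smooth_on UNIV (\<lambda>x::real^'m. cos (x $ i))"
proof -
  have F: "\<exists>h\<in>{sin, cos}. \<exists>c. \<forall>t. (g has_real_derivative c * h t) (at t)" if g: "g \<in> {sin, cos}" for g :: "real \<Rightarrow> real"
  proof (cases "g = sin")
    case True
    then show ?thesis by (auto intro!: exI[of _ 1] derivative_eq_intros)
  next
    case False
    have "\<forall>t. (cos has_real_derivative (-1) * sin t) (at t)"
      by (auto intro!: derivative_eq_intros)
    with False g show ?thesis by blast
  qed
  show "smooth_on UNIV (\<lambda>x::real^'m. sin (x $ i))" "smooth_on UNIV (\<lambda>x::real^'m. cos (x $ i))"
    by (rule smooth_comp_component[OF F]; simp)+
qed

lemma smooth_sinh_component [intro]: "smooth_on UNIV (\<lambda>x::real^'m. sinh (\<kappa> * x $ i))"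
proof -
  define S C where "S = (\<lambda>t. sinh (\<kappa> * t))" and "C = (\<lambda>t. cosh (\<kappa> * t))"
  have "\<forall>t. (S has_real_derivative \<kappa> * C t) (at t)" "\<forall>t. (C has_real_derivative \<kappa> * S t) (at t)"
    unfolding S_def C_def by (auto intro!: derivative_eq_intros)
  then have F: "\<exists>h\<in>{S, C}. \<exists>c. \<forall>t. (g has_real_derivative c * h t) (at t)" if "g \<in> {S, C}" for g
    using that by blast
  have "smooth_on UNIV (\<lambda>x::real^'m. S (x $ i))" by (rule smooth_comp_component[OF F]; simp)
  then show ?thesis by (simp add: S_def)
qed

section \<open>Symmetry of second derivatives\<close>

lemma dir_deriv_along_line:
  fixes f :: "'e::euclidean_space \<Rightarrow> real"
  assumes "f differentiable (at (p + t *\<^sub>R u))"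
  shows "((\<lambda>t. f (p + t *\<^sub>R u)) has_real_derivative dir_deriv u f (p + t *\<^sub>R u)) (at t)"
proof -
  have "((\<lambda>t. p + t *\<^sub>R u) has_derivative (\<lambda>s. s *\<^sub>R u)) (at t)"
    by (auto intro!: derivative_eq_intros)
  from has_derivative_compose[OF this has_derivative_dir_deriv[OF assms]]
  have "((\<lambda>t. f (p + t *\<^sub>R u)) has_derivative (\<lambda>s. dir_deriv (s *\<^sub>R u) f (p + t *\<^sub>R u))) (at t)" .
  moreover have "dir_deriv (s *\<^sub>R u) f (p + t *\<^sub>R u) = dir_deriv u f (p + t *\<^sub>R u) * s" for s
    using linear_scale[OF dir_deriv_linear[OF assms]] by simp
  ultimately show ?thesis by (simp add: has_field_derivative_def)
qed

text \<open>The left-hand side is symmetric in \<open>u\<close> and \<open>v\<close>, while the right-hand side, from the mean value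
  theorem in direction \<open>u\<close> and then in direction \<open>v\<close>, is not: for small \<open>h\<close> it approaches the
  iterated derivative in one particular order.\<close>

lemma second_difference_mean_value:
  fixes f :: "'e::euclidean_space \<Rightarrow> real"
  assumes f: "smooth_on UNIV f" and h: "0 < h"
  shows "\<exists>s t. 0 < s \<and> s < h \<and> 0 < t \<and> t < h \<and>
    f (p + h *\<^sub>R u + h *\<^sub>R v) - f (p + h *\<^sub>R u) - f (p + h *\<^sub>R v) + f p
      = h\<^sup>2 * dir_deriv v (dir_deriv u f) (p + s *\<^sub>R u + t *\<^sub>R v)"
proof -
  define \<phi> where "\<phi> s = f ((p + h *\<^sub>R v) + s *\<^sub>R u) - f (p + s *\<^sub>R u)" for s
  define \<phi>' where "\<phi>' s = dir_deriv u f ((p + h *\<^sub>R v) + s *\<^sub>R u) - dir_deriv u f (p + s *\<^sub>R u)" for s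
  have "(\<phi> has_real_derivative \<phi>' s) (at s)" for s
    unfolding \<phi>_def \<phi>'_def
    by (intro DERIV_diff dir_deriv_along_line smooth_differentiable f)
  with MVT2[OF h, of \<phi> \<phi>'] obtain s where s: "0 < s" "s < h" "\<phi> h - \<phi> 0 = h * \<phi>' s"
    by auto
  define \<psi> where "\<psi> t = dir_deriv u f ((p + s *\<^sub>R u) + t *\<^sub>R v)" for t
  have "(\<psi> has_real_derivative dir_deriv v (dir_deriv u f) ((p + s *\<^sub>R u) + t *\<^sub>R v)) (at t)" for t
    unfolding \<psi>_def by (intro dir_deriv_along_line smooth_differentiable smooth_dir_deriv f)
  with MVT2[OF h, of \<psi> "\<lambda>t. dir_deriv v (dir_deriv u f) ((p + s *\<^sub>R u) + t *\<^sub>R v)"]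
  obtain t where t: "0 < t" "t < h" "\<psi> h - \<psi> 0 = h * dir_deriv v (dir_deriv u f) ((p + s *\<^sub>R u) + t *\<^sub>R v)"
    by auto
  have "\<phi> h - \<phi> 0 = h\<^sup>2 * dir_deriv v (dir_deriv u f) (p + s *\<^sub>R u + t *\<^sub>R v)"
    using s(3) t(3) by (simp add: \<phi>'_def \<psi>_def power2_eq_square algebra_simps)
  then show ?thesis
    using s t by (intro exI[of _ s] exI[of _ t]) (simp add: \<phi>_def algebra_simps)
qed

lemma dir_deriv_commute:
  fixes f :: "'e::euclidean_space \<Rightarrow> real"
  assumes f: "smooth_on UNIV f"
  shows "dir_deriv v (dir_deriv u f) p = dir_deriv u (dir_deriv v f) p"
proof -
  define \<Delta> where "\<Delta> u v h = f (p + h *\<^sub>R u + h *\<^sub>R v) - f (p + h *\<^sub>R u) - f (p + h *\<^sub>R v) + f p"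
    for u v and h :: real
  define h where "h n = inverse (real (Suc n))" for n
  have h0: "h \<longlonglongrightarrow> 0" unfolding h_def by (rule LIMSEQ_inverse_real_of_nat)
  have lim: "(\<lambda>n. \<Delta> u v (h n) / (h n)\<^sup>2) \<longlonglongrightarrow> dir_deriv v (dir_deriv u f) p" for u v
  proof -
    have hp: "0 < h n" for n by (simp add: h_def)
    have "\<forall>n. \<exists>s t. 0 < s \<and> s < h n \<and> 0 < t \<and> t < h n \<and>
        \<Delta> u v (h n) = (h n)\<^sup>2 * dir_deriv v (dir_deriv u f) (p + s *\<^sub>R u + t *\<^sub>R v)"
      unfolding \<Delta>_def by (intro allI second_difference_mean_value f hp)
    then obtain s t where st: "\<And>n. 0 < s n" "\<And>n. s n < h n" "\<And>n. 0 < t n" "\<And>n. t n < h n"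
        "\<And>n. \<Delta> u v (h n) = (h n)\<^sup>2 * dir_deriv v (dir_deriv u f) (p + s n *\<^sub>R u + t n *\<^sub>R v)"
      by metis
    have "s \<longlonglongrightarrow> 0" "t \<longlonglongrightarrow> 0"
      by (rule tendsto_sandwich[OF _ _ tendsto_const h0];
          use st in \<open>auto intro!: always_eventually less_imp_le\<close>)+
    then have "(\<lambda>n. p + s n *\<^sub>R u + t n *\<^sub>R v) \<longlonglongrightarrow> p + 0 *\<^sub>R u + 0 *\<^sub>R v"
      by (intro tendsto_intros)
    moreover have "isCont (dir_deriv v (dir_deriv u f)) p"
      using smooth_continuous[OF smooth_dir_deriv[OF smooth_dir_deriv[OF f]]]
      by (simp add: continuous_on_eq_continuous_at)
    ultimately have "(\<lambda>n. dir_deriv v (dir_deriv u f) (p + s n *\<^sub>R u + t n *\<^sub>R v)) \<longlonglongrightarrow> dir_deriv v (dir_deriv u f) p"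
      using isCont_tendsto_compose by fastforce
    moreover have "\<Delta> u v (h n) / (h n)\<^sup>2 = dir_deriv v (dir_deriv u f) (p + s n *\<^sub>R u + t n *\<^sub>R v)" for n
      using st(5)[of n] hp[of n] by simp
    ultimately show ?thesis by simp
  qed
  moreover have "\<Delta> v u = \<Delta> u v"
    by (simp add: \<Delta>_def fun_eq_iff algebra_simps)
  ultimately show ?thesis
    using LIMSEQ_unique[OF lim[of u v]] lim[of v u] by simp
qed

section \<open>Spectra without bases\<close>

lemma representation_sum_list:
  fixes bs :: "'v::real_vector list"
  assumes "distinct bs" "independent (set bs)" "i < length bs"
  shows "representation (set bs) (\<Sum>j<length bs. c j *\<^sub>R bs ! j) (bs ! i) = c i"
proof -
  have "representation (set bs) (\<Sum>j<length bs. c j *\<^sub>R bs ! j) (bs ! i)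
      = (\<Sum>j<length bs. representation (set bs) (c j *\<^sub>R bs ! j) (bs ! i))"
    by (subst representation_sum[OF assms(2)]) (simp_all add: span_scale span_base)
  also have "\<dots> = (\<Sum>j<length bs. if j = i then c j else 0)"
    using assms
    by (simp add: representation_scale span_base representation_basis nth_eq_iff_index_eq
        mult_delta_right eq_commute[of i])
  finally show ?thesis using assms(3) by simp
qed

lemma sum_list_representation:
  fixes bs :: "'v::real_vector list"
  assumes "distinct bs" "independent (set bs)" "x \<in> span (set bs)"
  shows "(\<Sum>i<length bs. representation (set bs) x (bs ! i) *\<^sub>R bs ! i) = x"
proof -
  have "(\<Sum>i<length bs. representation (set bs) x (bs ! i) *\<^sub>R bs ! i)
      = (\<Sum>b\<in>set bs. representation (set bs) x b *\<^sub>R b)"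
    by (rule sum.reindex_bij_betw) (rule bij_betw_nth[OF assms(1)]; simp)
  also have "\<dots> = x" by (rule sum_representation_eq[OF assms(2,3)]) auto
  finally show ?thesis .
qed

lemma linear_within_sum:
  assumes "linear_within V T" "subspace V" "\<And>i. i \<in> I \<Longrightarrow> f i \<in> V"
  shows "T (\<Sum>i\<in>I. c i *\<^sub>R f i) = (\<Sum>i\<in>I. c i *\<^sub>R T (f i))"
  using assms(3)
proof (induction I rule: infinite_finite_induct)
  case (infinite I)
  have "T (0 *\<^sub>R 0) = 0 *\<^sub>R T 0"
    using assms(1) subspace_0[OF assms(2)] unfolding linear_within_def by blast
  with infinite show ?case by simp
next
  case empty
  have "T (0 *\<^sub>R 0) = 0 *\<^sub>R T 0"
    using assms(1) subspace_0[OF assms(2)] unfolding linear_within_def by blast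
  then show ?case by simp
next
  case (insert i I)
  have "c i *\<^sub>R f i \<in> V" "(\<Sum>i\<in>I. c i *\<^sub>R f i) \<in> V"
    using insert by (auto intro!: subspace_scale subspace_sum assms(2))
  with insert assms(1) show ?case
    by (simp add: linear_within_def)
qed

lemma linear_within_matrix:
  assumes bs: "ordered_basis V bs" and T: "linear_within V T"
  shows "T (\<Sum>j<length bs. c j *\<^sub>R bs ! j)
    = (\<Sum>i<length bs. (\<Sum>j<length bs. matrix_wrt bs T $$ (i, j) * c j) *\<^sub>R bs ! i)"
proof -
  have ob: "distinct bs" "independent (set bs)" "span (set bs) = V"
    using bs by (auto simp: ordered_basis_def)
  have V: "subspace V" using ob(3) by auto
  have inV: "bs ! j \<in> V" if "j < length bs" for j
    using that ob(3) by (metis nth_mem span_base)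
  have "T (\<Sum>j<length bs. c j *\<^sub>R bs ! j) = (\<Sum>j<length bs. c j *\<^sub>R T (bs ! j))"
    using inV by (intro linear_within_sum[OF T V]) auto
  also have "\<dots> = (\<Sum>j<length bs. \<Sum>i<length bs. (matrix_wrt bs T $$ (i, j) * c j) *\<^sub>R bs ! i)"
  proof (rule sum.cong[OF refl])
    fix j assume j: "j \<in> {..<length bs}"
    then have "T (bs ! j) \<in> span (set bs)"
      using T inV ob(3) by (simp add: linear_within_def)
    from sum_list_representation[OF ob(1,2) this]
    have "T (bs ! j) = (\<Sum>i<length bs. matrix_wrt bs T $$ (i, j) *\<^sub>R bs ! i)"
      using j by (simp add: matrix_wrt_def)
    then show "c j *\<^sub>R T (bs ! j) = (\<Sum>i<length bs. (matrix_wrt bs T $$ (i, j) * c j) *\<^sub>R bs ! i)"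
      by (simp add: scaleR_sum_right mult.commute)
  qed
  also have "\<dots> = (\<Sum>i<length bs. (\<Sum>j<length bs. matrix_wrt bs T $$ (i, j) * c j) *\<^sub>R bs ! i)"
    by (subst sum.swap) (simp add: scaleR_sum_left)
  finally show ?thesis .
qed

lemma finite_dim_space_ordered_basis:
  assumes "finite_dim_space V"
  shows "\<exists>bs. ordered_basis V bs"
proof -
  from assms obtain B where B: "finite B" "V = span B" by (auto simp: finite_dim_space_def)
  obtain C where C: "C \<subseteq> B" "independent C" "span C = V"
    using maximal_independent_subset[of B] B(2)
    by (metis span_eq span_superset subset_trans span_minimal subspace_span)
  then obtain bs where "set bs = C" "distinct bs"
    using finite_distinct_list B(1) finite_subset by metis
  with C show ?thesis by (auto simp: ordered_basis_def)
qed

lemma eigen_equation_iff_char_poly_root: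
  fixes M :: "real Matrix.mat"
  assumes M: "M \<in> carrier_mat n n"
  shows "poly (map_poly complex_of_real (char_poly M)) z = 0 \<longleftrightarrow>
    (\<exists>w. (\<exists>i<n. w i \<noteq> 0) \<and> (\<forall>i<n. (\<Sum>j<n. of_real (M $$ (i, j)) * w j) = z * w i))"
proof -
  let ?M = "map_mat complex_of_real M"
  have cM: "?M \<in> carrier_mat n n" using M by simp
  have mult: "(?M *\<^sub>v v) = z \<cdot>\<^sub>v v \<longleftrightarrow> (\<forall>i<n. (\<Sum>j<n. of_real (M $$ (i, j)) * Matrix.vec_index v j) = z * Matrix.vec_index v i)"
    if "v \<in> carrier_vec n" for v
    using M that by (auto simp: vec_eq_iff Matrix.scalar_prod_def atLeast0LessThan)
  have "poly (map_poly complex_of_real (char_poly M)) z = 0 \<longleftrightarrow> eigenvalue ?M z"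
    unfolding eigenvalue_root_char_poly[OF cM] of_real_hom.char_poly_hom[OF M] ..
  also have "\<dots> \<longleftrightarrow> (\<exists>v\<in>carrier_vec n. v \<noteq> 0\<^sub>v n \<and> ?M *\<^sub>v v = z \<cdot>\<^sub>v v)"
    using M by (auto simp: eigenvalue_def eigenvector_def)
  also have "\<dots> \<longleftrightarrow> (\<exists>w. (\<exists>i<n. w i \<noteq> 0) \<and> (\<forall>i<n. (\<Sum>j<n. of_real (M $$ (i, j)) * w j) = z * w i))"
  proof
    assume "\<exists>v\<in>carrier_vec n. v \<noteq> 0\<^sub>v n \<and> ?M *\<^sub>v v = z \<cdot>\<^sub>v v"
    then obtain v where v: "v \<in> carrier_vec n" "v \<noteq> 0\<^sub>v n" "?M *\<^sub>v v = z \<cdot>\<^sub>v v"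
      by blast
    then have "\<exists>i<n. Matrix.vec_index v i \<noteq> 0" by (auto simp: vec_eq_iff)
    with v show "\<exists>w. (\<exists>i<n. w i \<noteq> 0) \<and> (\<forall>i<n. (\<Sum>j<n. of_real (M $$ (i, j)) * w j) = z * w i)"
      unfolding mult[OF v(1)] by blast
  next
    assume "\<exists>w. (\<exists>i<n. w i \<noteq> 0) \<and> (\<forall>i<n. (\<Sum>j<n. of_real (M $$ (i, j)) * w j) = z * w i)"
    then obtain w where w: "\<exists>i<n. w i \<noteq> 0" "\<forall>i<n. (\<Sum>j<n. complex_of_real (M $$ (i, j)) * w j) = z * w i"
      by blast
    show "\<exists>v\<in>carrier_vec n. v \<noteq> 0\<^sub>v n \<and> ?M *\<^sub>v v = z \<cdot>\<^sub>v v"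
    proof (intro bexI[of _ "Matrix.vec n w"] conjI)
      show "?M *\<^sub>v Matrix.vec n w = z \<cdot>\<^sub>v Matrix.vec n w"
        using w(2) by (subst mult) auto
    qed (use w in \<open>auto simp: vec_eq_iff\<close>)
  qed
  finally show ?thesis .
qed

text \<open>The pair of \<open>x\<close> and \<open>y\<close> stands for the vector \<open>x + \<i> y\<close> of the complexification of \<open>V\<close>, and the two
  equations are the real and imaginary parts of \<open>T (x + \<i> y) = z (x + \<i> y)\<close>.\<close>

lemma Spec_iff:
  assumes V: "finite_dim_space V" and T: "linear_within V T"
  shows "z \<in> Spec V T \<longleftrightarrow> (\<exists>x\<in>V. \<exists>y\<in>V. (x \<noteq> 0 \<or> y \<noteq> 0) \<and>
    T x = Re z *\<^sub>R x - Im z *\<^sub>R y \<and> T y = Im z *\<^sub>R x + Re z *\<^sub>R y)"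
proof -
  define bs where "bs = (SOME bs. ordered_basis V bs)"
  have bs: "ordered_basis V bs"
    unfolding bs_def by (rule someI_ex) (rule finite_dim_space_ordered_basis[OF V])
  then have ob: "distinct bs" "independent (set bs)" "span (set bs) = V"
    by (auto simp: ordered_basis_def)
  let ?n = "length bs" and ?M = "matrix_wrt bs T"
  let ?rep = "\<lambda>x i. representation (set bs) x (bs ! i)"
  have inV: "(\<Sum>j<?n. c j *\<^sub>R bs ! j) \<in> V" for c
    using ob(3) by (metis (no_types, lifting) lessThan_iff nth_mem span_base span_scale span_sum)
  have eqI: "x = y" if "x \<in> V" "y \<in> V" "\<And>i. i < ?n \<Longrightarrow> ?rep x i = ?rep y i" for x y
    using sum_list_representation[OF ob(1,2), of x] sum_list_representation[OF ob(1,2), of y] that ob(3)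
    by (metis (no_types, lifting) lessThan_iff sum.cong)
  have M: "?M \<in> carrier_mat ?n ?n" by (simp add: matrix_wrt_def)
  have "z \<in> Spec V T \<longleftrightarrow> (\<exists>w. (\<exists>i<?n. w i \<noteq> 0) \<and> (\<forall>i<?n. (\<Sum>j<?n. of_real (?M $$ (i, j)) * w j) = z * w i))"
    unfolding Spec_def char_polynomial_def bs_def[symmetric]
    using eigen_equation_iff_char_poly_root[OF M] by simp
  also have "\<dots> \<longleftrightarrow> (\<exists>x\<in>V. \<exists>y\<in>V. (x \<noteq> 0 \<or> y \<noteq> 0) \<and>
    T x = Re z *\<^sub>R x - Im z *\<^sub>R y \<and> T y = Im z *\<^sub>R x + Re z *\<^sub>R y)"
  proof
    assume "\<exists>w. (\<exists>i<?n. w i \<noteq> 0) \<and> (\<forall>i<?n. (\<Sum>j<?n. of_real (?M $$ (i, j)) * w j) = z * w i)"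
    then obtain w where nz: "\<exists>i<?n. w i \<noteq> 0"
      and w: "\<forall>i<?n. (\<Sum>j<?n. complex_of_real (?M $$ (i, j)) * w j) = z * w i"
      by blast
    define x y where "x = (\<Sum>j<?n. Re (w j) *\<^sub>R bs ! j)" and "y = (\<Sum>j<?n. Im (w j) *\<^sub>R bs ! j)"
    have xy: "x \<in> V" "y \<in> V" by (auto simp: x_def y_def inV)
    have "x \<noteq> 0 \<or> y \<noteq> 0"
    proof (rule ccontr)
      assume "\<not> (x \<noteq> 0 \<or> y \<noteq> 0)"
      then have "?rep x i = 0" "?rep y i = 0" for i
        by (auto simp: representation_zero)
      then have "Re (w i) = 0" "Im (w i) = 0" if "i < ?n" for i
        using that representation_sum_list[OF ob(1,2) that, of "\<lambda>j. Re (w j)"]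
          representation_sum_list[OF ob(1,2) that, of "\<lambda>j. Im (w j)"]
        by (auto simp: x_def y_def)
      then show False using nz by (auto simp: complex_eq_iff)
    qed
    moreover have re: "(\<Sum>j<?n. ?M $$ (i, j) * Re (w j)) = Re z * Re (w i) - Im z * Im (w i)" if "i < ?n" for i
      using arg_cong[where f = Re, OF w[rule_format, OF that]] by simp
    then have "T x = Re z *\<^sub>R x - Im z *\<^sub>R y"
      unfolding x_def y_def linear_within_matrix[OF bs T]
      by (simp add: scaleR_sum_right scaleR_diff_left sum_subtractf)
    moreover have im: "(\<Sum>j<?n. ?M $$ (i, j) * Im (w j)) = Re z * Im (w i) + Im z * Re (w i)" if "i < ?n" for i
      using arg_cong[where f = Im, OF w[rule_format, OF that]] by simp
    then have "T y = Im z *\<^sub>R x + Re z *\<^sub>R y"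
      unfolding x_def y_def linear_within_matrix[OF bs T]
      by (simp add: scaleR_sum_right scaleR_add_left sum.distrib)
    ultimately show "\<exists>x\<in>V. \<exists>y\<in>V. (x \<noteq> 0 \<or> y \<noteq> 0) \<and>
        T x = Re z *\<^sub>R x - Im z *\<^sub>R y \<and> T y = Im z *\<^sub>R x + Re z *\<^sub>R y"
      using xy by blast
  next
    assume "\<exists>x\<in>V. \<exists>y\<in>V. (x \<noteq> 0 \<or> y \<noteq> 0) \<and>
      T x = Re z *\<^sub>R x - Im z *\<^sub>R y \<and> T y = Im z *\<^sub>R x + Re z *\<^sub>R y"
    then obtain x y where xy: "x \<in> V" "y \<in> V" and nz: "x \<noteq> 0 \<or> y \<noteq> 0"
      and Tx: "T x = Re z *\<^sub>R x - Im z *\<^sub>R y" and Ty: "T y = Im z *\<^sub>R x + Re z *\<^sub>R y"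
      by blast
    have rT: "(\<Sum>j<?n. ?M $$ (i, j) * ?rep u j) = ?rep (T u) i" if "u \<in> V" "i < ?n" for u i
    proof -
      have "T u = T (\<Sum>j<?n. ?rep u j *\<^sub>R bs ! j)"
        using sum_list_representation[OF ob(1,2), of u] that ob(3) by simp
      then show ?thesis
        unfolding linear_within_matrix[OF bs T] using representation_sum_list[OF ob(1,2) that(2)] by simp
    qed
    have rl: "?rep (a *\<^sub>R x + b *\<^sub>R y) i = a * ?rep x i + b * ?rep y i" for a b i
      using xy unfolding ob(3)[symmetric]
      by (simp add: representation_add[OF ob(2)] representation_scale[OF ob(2)] span_scale)
    have rx: "?rep (T x) i = Re z * ?rep x i - Im z * ?rep y i" for i
      using rl[of "Re z" "- Im z" i] by (simp add: Tx)
    have ry: "?rep (T y) i = Im z * ?rep x i + Re z * ?rep y i" for i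
      using rl[of "Im z" "Re z" i] by (simp add: Ty)
    show "\<exists>w. (\<exists>i<?n. w i \<noteq> 0) \<and> (\<forall>i<?n. (\<Sum>j<?n. of_real (?M $$ (i, j)) * w j) = z * w i)"
    proof (intro exI[of _ "\<lambda>i. Complex (?rep x i) (?rep y i)"] conjI allI impI)
      have "0 \<in> V" using ob(3) span_zero by blast
      then show "\<exists>i<?n. Complex (?rep x i) (?rep y i) \<noteq> 0"
        using nz eqI[OF xy(1), of 0] eqI[OF xy(2), of 0]
        by (auto simp: complex_eq_iff representation_zero)
      fix i assume i: "i < ?n"
      show "(\<Sum>j<?n. complex_of_real (?M $$ (i, j)) * Complex (?rep x j) (?rep y j))
          = z * Complex (?rep x i) (?rep y i)"
        using rT[OF xy(1) i] rT[OF xy(2) i] rx[of i] ry[of i]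
        by (simp add: complex_eq_iff)
    qed
  qed
  finally show ?thesis .
qed

lemma linear_imp_linear_within: "linear T \<Longrightarrow> linear_within UNIV T"
  by (simp add: linear_within_def linear_add linear_scale)

lemma finite_dim_space_UNIV: "finite_dim_space (UNIV :: 'e::euclidean_space set)"
  unfolding finite_dim_space_def by (auto intro!: exI[of _ Basis])

lemma finite_dim_space_range:
  fixes L :: "'e::euclidean_space \<Rightarrow> 'v::real_vector"
  assumes "linear L"
  shows "finite_dim_space (range L)"
proof -
  have "range L = span (L ` Basis)"
    using linear_span_image[OF assms, of Basis] by simp
  then show ?thesis
    unfolding finite_dim_space_def by (metis finite_imageI finite_Basis subspace_span)
qed

text \<open>Spectra are invariant under isomorphism. With \<open>L\<close> the map from coordinates to tangent vectors, this
  reduces the Jacobi operators of a manifold to operators on \<open>\<real>\<^sup>m\<close>.\<close>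

lemma Spec_range:
  fixes L :: "'e::euclidean_space \<Rightarrow> 'v::real_vector"
  assumes L: "linear L" "inj L" and T: "linear T" and S: "\<And>u. S (L u) = L (T u)"
  shows "Spec (range L) S = Spec UNIV T"
proof -
  have lS: "linear_within (range L) S"
    unfolding linear_within_def
    using L(1) T by (auto simp: S linear_add[symmetric] linear_scale[symmetric])
  have eq: "L u = L v \<longleftrightarrow> u = v" for u v using L(2) by (auto dest: injD)
  have eq0: "L u = 0 \<longleftrightarrow> u = 0" for u using eq[of u 0] linear_0[OF L(1)] by simp
  have "z \<in> Spec (range L) S \<longleftrightarrow> z \<in> Spec UNIV T" for z
    unfolding Spec_iff[OF finite_dim_space_range[OF L(1)] lS]
      Spec_iff[OF finite_dim_space_UNIV linear_imp_linear_within[OF T]]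
    using L(1)
    by (simp add: S eq eq0 linear_add[symmetric] linear_diff[symmetric] linear_scale[symmetric])
  then show ?thesis by blast
qed

text \<open>The last assumption says that \<open>(T - l)\<^sup>2 u = g(u) v\<close>. As \<open>T v = 0\<close>, this gives \<open>T (T - l)\<^sup>2 = 0\<close>, so that
  there are no other eigenvalues. In dimension at least 2 the linear functional \<open>g\<close> has a non-trivial
  zero \<open>u\<close>, and then \<open>u\<close> or \<open>(T - l) u\<close> is an eigenvector for \<open>l\<close>.\<close>

lemma Spec_eq_0_eigenvalue:
  fixes T :: "'e::euclidean_space \<Rightarrow> 'e"
  assumes T: "linear T" and v: "v \<noteq> 0" "T v = 0" and dim: "2 \<le> DIM('e)"
    and g: "linear g" "\<And>u. T (T u) - (2 * l) *\<^sub>R T u + l\<^sup>2 *\<^sub>R u = g u *\<^sub>R v"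
  shows "Spec UNIV T = {0, complex_of_real l}"
proof
  note iff = Spec_iff[OF finite_dim_space_UNIV linear_imp_linear_within[OF T]]
  have eig: "complex_of_real c \<in> Spec UNIV T" if "u \<noteq> 0" "T u = c *\<^sub>R u" for u c
    unfolding iff using that linear_0[OF T] by (intro bexI[of _ u] bexI[of _ 0]) auto
  have "0 \<in> Spec UNIV T" using eig[of v 0] v by simp
  moreover have "complex_of_real l \<in> Spec UNIV T"
  proof -
    have "\<not> inj g"
    proof
      assume "inj g"
      then have "dim (range g) = DIM('e)"
        using dim_image_eq[OF g(1), of UNIV] by simp
      moreover have "dim (range g) \<le> DIM(real)" by (rule dim_subset_UNIV)
      ultimately have "DIM('e) \<le> DIM(real)" by simp
      with dim show False by simp
    qed
    then obtain u where u: "u \<noteq> 0" "g u = 0"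
      using linear_injective_0[OF g(1)] by blast
    let ?w = "T u - l *\<^sub>R u"
    have "T ?w = l *\<^sub>R ?w"
    proof -
      have "T (T u) = l *\<^sub>R T u + l *\<^sub>R T u - l\<^sup>2 *\<^sub>R u"
        using g(2)[of u] u(2) by (simp add: algebra_simps flip: scaleR_left_distrib)
      then show ?thesis
        using T by (simp add: linear_diff linear_scale power2_eq_square algebra_simps)
    qed
    show ?thesis
    proof (cases "?w = 0")
      case True
      then show ?thesis using eig[OF u(1), of l] by simp
    next
      case False
      then show ?thesis using eig[OF _ \<open>T ?w = l *\<^sub>R ?w\<close>] by simp
    qed
  qed
  ultimately show "{0, complex_of_real l} \<subseteq> Spec UNIV T" by simp
next
  show "Spec UNIV T \<subseteq> {0, complex_of_real l}"
  proof
    fix z assume "z \<in> Spec UNIV T"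
    then obtain x y where nz: "x \<noteq> 0 \<or> y \<noteq> 0"
      and Tx: "T x = Re z *\<^sub>R x - Im z *\<^sub>R y" and Ty: "T y = Im z *\<^sub>R x + Re z *\<^sub>R y"
      unfolding Spec_iff[OF finite_dim_space_UNIV linear_imp_linear_within[OF T]] by auto
    \<comment> \<open>Multiplication by a complex number on the complexification, seen as pairs of
      real and imaginary parts.\<close>
    define act where "act c p = (Re c *\<^sub>R fst p - Im c *\<^sub>R snd p, Im c *\<^sub>R fst p + Re c *\<^sub>R snd p)"
      for c and p :: "'e \<times> 'e"
    define T2 where "T2 p = (T (fst p), T (snd p))" for p
    have act_act: "act c (act d p) = act (c * d) p" for c d p
      by (simp add: act_def algebra_simps)
    have act_add: "act c p + act d p = act (c + d) p" for c d p
      by (simp add: act_def algebra_simps)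
    have act_scale: "r *\<^sub>R act c p = act (of_real r * c) p" for r c p
      by (simp add: act_def algebra_simps)
    have T2: "T2 (x, y) = act z (x, y)" by (simp add: T2_def act_def Tx Ty)
    have T2_act: "T2 (act c (x, y)) = act (c * z) (x, y)" for c
      by (simp add: T2_def act_def linear_add[OF T] linear_diff[OF T] linear_scale[OF T] Tx Ty algebra_simps)
    have Q: "T (T (T u) - (2 * l) *\<^sub>R T u + l\<^sup>2 *\<^sub>R u) = 0" for u
      by (simp add: g(2) linear_scale[OF T] v)
    have "T2 (act ((z - of_real l)\<^sup>2) (x, y)) = 0"
    proof -
      have "act ((z - of_real l)\<^sup>2) (x, y) = T2 (T2 (x, y)) - (2 * l) *\<^sub>R T2 (x, y) + l\<^sup>2 *\<^sub>R (x, y)"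
        unfolding T2 T2_act
        by (simp add: act_def power2_eq_square algebra_simps)
      also have "\<dots> = (T (T x) - (2 * l) *\<^sub>R T x + l\<^sup>2 *\<^sub>R x, T (T y) - (2 * l) *\<^sub>R T y + l\<^sup>2 *\<^sub>R y)"
        by (simp add: T2_def)
      finally show ?thesis by (simp add: T2_def Q zero_prod_def)
    qed
    then have "act ((z - of_real l)\<^sup>2 * z) (x, y) = 0" by (simp only: T2_act)
    moreover have "c = 0" if "act c (x, y) = 0" for c
    proof (rule ccontr)
      assume "c \<noteq> 0"
      then have "act (inverse c) (act c (x, y)) = act 1 (x, y)" by (simp add: act_act)
      with that nz show False by (auto simp: act_def zero_prod_def)
    qed
    ultimately have "(z - of_real l)\<^sup>2 * z = 0" by blast
    then show "z \<in> {0, complex_of_real l}" by auto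
  qed
qed

section \<open>Vector fields on \<open>\<real>\<^sup>m\<close>\<close>

abbreviation std_atlas :: "(real^'m, real^'m) chart set"
  where "std_atlas \<equiv> {(UNIV, id)}"

lemma smooth_functions_std: "smooth_functions euclidean std_atlas = {f. smooth_on UNIV f}"
  by (simp add: smooth_functions_def)

definition tangent_vec :: "real^'m \<Rightarrow> real^'m \<Rightarrow> (real^'m) tangent"
  where "tangent_vec p u = (\<lambda>f. if smooth_on UNIV f then dir_deriv u f p else 0)"

lemma tangent_space_std: "tangent_space euclidean std_atlas p = range (tangent_vec p)"
proof -
  have "coordinate_derivation euclidean std_atlas (UNIV, id) p u = tangent_vec p u" for u
    by (simp add: fun_eq_iff coordinate_derivation_def smooth_functions_std tangent_vec_def dir_deriv_def)
  then show ?thesis by (auto simp: tangent_space_def)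
qed

lemma linear_tangent_vec: "linear (tangent_vec p)"
proof (rule linearI)
  show "tangent_vec p (u + v) = tangent_vec p u + tangent_vec p v" for u v
    by (auto simp: tangent_vec_def fun_eq_iff linear_add[OF dir_deriv_linear[OF smooth_differentiable]])
  show "tangent_vec p (r *\<^sub>R u) = r *\<^sub>R tangent_vec p u" for r u
    by (auto simp: tangent_vec_def fun_eq_iff scaleR_fun_def linear_scale[OF dir_deriv_linear[OF smooth_differentiable]])
qed

text \<open>A tangent vector is recovered from its values at the coordinate functions.\<close>

definition components :: "(real^'m) tangent \<Rightarrow> real^'m"
  where "components w = (\<chi> i. w (\<lambda>q. q $ i))"

lemma components_tangent_vec [simp]: "components (tangent_vec p u) = u"
  by (simp add: components_def tangent_vec_def Finite_Cartesian_Product.vec_eq_iff smooth_component)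

lemma inj_tangent_vec: "inj (tangent_vec p)"
  by (metis components_tangent_vec injI)

lemma vec_expand: "u = (\<Sum>i\<in>UNIV. u $ i *\<^sub>R axis i (1::real))"
  by (simp add: Finite_Cartesian_Product.vec_eq_iff axis_def mult_delta_right if_distrib cong: if_cong)

lemma dir_deriv_expand:
  assumes "f differentiable (at (p::real^'m))"
  shows "dir_deriv u f p = (\<Sum>i\<in>UNIV. u $ i * dir_deriv (axis i 1) f p)"
proof -
  have "dir_deriv u f p = dir_deriv (\<Sum>i\<in>UNIV. u $ i *\<^sub>R axis i 1) f p"
    by (subst vec_expand[of u]) (rule refl)
  also have "\<dots> = (\<Sum>i\<in>UNIV. u $ i * dir_deriv (axis i 1) f p)"
    by (simp add: linear_sum[OF dir_deriv_linear[OF assms]] linear_scale[OF dir_deriv_linear[OF assms]])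
  finally show ?thesis .
qed

definition smooth_vec :: "(real^'m \<Rightarrow> real^'m) \<Rightarrow> bool"
  where "smooth_vec \<xi> \<longleftrightarrow> (\<forall>i. smooth_on UNIV (\<lambda>p. \<xi> p $ i))"

lemma smooth_vec_const [simp]: "smooth_vec (\<lambda>p. u)"
  by (simp add: smooth_vec_def)

lemma smooth_vec_add: "smooth_vec \<xi> \<Longrightarrow> smooth_vec \<eta> \<Longrightarrow> smooth_vec (\<lambda>p. \<xi> p + \<eta> p)"
  by (auto simp: smooth_vec_def)

lemma smooth_vec_diff: "smooth_vec \<xi> \<Longrightarrow> smooth_vec \<eta> \<Longrightarrow> smooth_vec (\<lambda>p. \<xi> p - \<eta> p)"
  by (auto simp: smooth_vec_def)

lemma smooth_vec_scale: "smooth_on UNIV f \<Longrightarrow> smooth_vec \<xi> \<Longrightarrow> smooth_vec (\<lambda>p. f p *\<^sub>R \<xi> p)"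
  by (auto simp: smooth_vec_def)

lemma smooth_dir_deriv_field:
  assumes "smooth_vec \<xi>" "smooth_on UNIV f"
  shows "smooth_on UNIV (\<lambda>p. dir_deriv (\<xi> p) f p)"
proof -
  have "(\<lambda>p. dir_deriv (\<xi> p) f p) = (\<lambda>p. \<Sum>i\<in>UNIV. \<xi> p $ i * dir_deriv (axis i 1) f p)"
    using dir_deriv_expand smooth_differentiable[OF assms(2)] by blast
  then show ?thesis
    using assms by (auto simp: smooth_vec_def intro!: smooth_sum smooth_mult smooth_dir_deriv)
qed

definition field_of :: "(real^'m \<Rightarrow> real^'m) \<Rightarrow> (real^'m) vector_field"
  where "field_of \<xi> = (\<lambda>p. tangent_vec p (\<xi> p))"

lemma field_of_add: "field_of \<xi> + field_of \<eta> = field_of (\<lambda>p. \<xi> p + \<eta> p)"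
  by (simp add: field_of_def fun_eq_iff linear_add[OF linear_tangent_vec])

lemma field_of_diff: "field_of \<xi> - field_of \<eta> = field_of (\<lambda>p. \<xi> p - \<eta> p)"
  by (simp add: field_of_def fun_eq_iff linear_diff[OF linear_tangent_vec])

lemma field_of_scale: "fscale f (field_of \<xi>) = field_of (\<lambda>p. f p *\<^sub>R \<xi> p)"
  by (simp add: fscale_def field_of_def linear_scale[OF linear_tangent_vec])

lemma field_of_apply: "smooth_on UNIV f \<Longrightarrow> field_of \<xi> p f = dir_deriv (\<xi> p) f p"
  by (simp add: field_of_def tangent_vec_def)

lemma field_of_apply_nonsmooth: "\<not> smooth_on UNIV f \<Longrightarrow> field_of \<xi> p f = 0"
  by (simp add: field_of_def tangent_vec_def)

lemma field_of_in_vector_fields: "smooth_vec \<xi> \<Longrightarrow> field_of \<xi> \<in> vector_fields euclidean std_atlas"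
  by (auto simp: vector_fields_def tangent_space_std smooth_functions_std field_of_apply smooth_dir_deriv_field)
     (simp add: field_of_def)

lemma vector_fields_std: "vector_fields euclidean std_atlas = field_of ` {\<xi>. smooth_vec \<xi>}"
proof
  show "vector_fields euclidean std_atlas \<subseteq> field_of ` {\<xi>. smooth_vec \<xi>}"
  proof
    fix X :: "(real^'m) vector_field" assume X: "X \<in> vector_fields euclidean std_atlas"
    have eq: "X = field_of (\<lambda>p. components (X p))"
    proof
      fix p
      obtain u where "X p = tangent_vec p u"
        using X by (auto simp: vector_fields_def tangent_space_std)
      then show "X p = field_of (\<lambda>p. components (X p)) p" by (simp add: field_of_def)
    qed
    moreover have "smooth_vec (\<lambda>p. components (X p))"
      using X smooth_component
      by (auto simp: smooth_vec_def components_def vector_fields_def smooth_functions_std)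
    ultimately show "X \<in> field_of ` {\<xi>. smooth_vec \<xi>}" by blast
  qed
qed (auto intro: field_of_in_vector_fields)

definition vec_deriv :: "real^'m \<Rightarrow> (real^'m \<Rightarrow> real^'m) \<Rightarrow> real^'m \<Rightarrow> real^'m"
  where "vec_deriv u \<eta> p = (\<chi> i. dir_deriv u (\<lambda>q. \<eta> q $ i) p)"

lemma smooth_vec_vec_deriv:
  "smooth_vec \<xi> \<Longrightarrow> smooth_vec \<eta> \<Longrightarrow> smooth_vec (\<lambda>p. vec_deriv (\<xi> p) \<eta> p)"
  unfolding smooth_vec_def[of \<eta>] smooth_vec_def[of "\<lambda>p. vec_deriv (\<xi> p) \<eta> p"]
  by (simp add: vec_deriv_def smooth_dir_deriv_field)

lemma smooth_vec_differentiable: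
  "smooth_vec \<eta> \<Longrightarrow> (\<lambda>q. \<eta> q $ i) differentiable (at p)"
  by (simp add: smooth_vec_def smooth_differentiable)

lemma linear_vec_deriv: "smooth_vec \<eta> \<Longrightarrow> linear (\<lambda>u. vec_deriv u \<eta> p)"
  by (rule linearI)
     (simp_all add: Finite_Cartesian_Product.vec_eq_iff vec_deriv_def linear_add[OF dir_deriv_linear[OF smooth_vec_differentiable]]
       linear_scale[OF dir_deriv_linear[OF smooth_vec_differentiable]])

lemma vec_deriv_const [simp]: "vec_deriv u (\<lambda>p. c) p = 0"
  by (simp add: vec_deriv_def Finite_Cartesian_Product.vec_eq_iff)

lemma vec_deriv_add:
  "smooth_vec \<xi> \<Longrightarrow> smooth_vec \<eta> \<Longrightarrow> vec_deriv u (\<lambda>p. \<xi> p + \<eta> p) p = vec_deriv u \<xi> p + vec_deriv u \<eta> p"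
  by (simp add: vec_deriv_def Finite_Cartesian_Product.vec_eq_iff dir_deriv_add smooth_vec_differentiable)

lemma vec_deriv_scale:
  "smooth_on UNIV f \<Longrightarrow> smooth_vec \<eta> \<Longrightarrow>
    vec_deriv u (\<lambda>p. f p *\<^sub>R \<eta> p) p = f p *\<^sub>R vec_deriv u \<eta> p + dir_deriv u f p *\<^sub>R \<eta> p"
  by (simp add: vec_deriv_def Finite_Cartesian_Product.vec_eq_iff dir_deriv_mult smooth_vec_differentiable smooth_differentiable)

lemma vec_deriv_sum:
  "(\<And>i. i \<in> I \<Longrightarrow> smooth_vec (\<eta> i)) \<Longrightarrow> vec_deriv u (\<lambda>p. \<Sum>i\<in>I. \<eta> i p) p = (\<Sum>i\<in>I. vec_deriv u (\<eta> i) p)"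
  by (simp add: vec_deriv_def Finite_Cartesian_Product.vec_eq_iff dir_deriv_sum smooth_vec_differentiable)

lemma smooth_vec_sum:
  "(\<And>i. i \<in> I \<Longrightarrow> smooth_vec (\<eta> i)) \<Longrightarrow> smooth_vec (\<lambda>p. \<Sum>i\<in>I. \<eta> i p)"
  by (auto simp: smooth_vec_def)

text \<open>Differentiating along a field \<open>\<eta>\<close> and then along \<open>u\<close> splits into a first-order term, from the
  derivative of \<open>\<eta>\<close>, and the second derivative of \<open>f\<close> with \<open>\<eta>\<close> held constant. The second derivative is
  symmetric and so disappears from commutators; this is the computation behind Lie brackets and
  curvature.\<close>

lemma dir_deriv_dir_deriv_field:
  assumes \<eta>: "smooth_vec \<eta>" and f: "smooth_on UNIV f"
  shows "dir_deriv u (\<lambda>q. dir_deriv (\<eta> q) f q) p = dir_deriv (vec_deriv u \<eta> p) f p + dir_deriv u (dir_deriv (\<eta> p) f) p"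
proof -
  have ex: "dir_deriv (\<theta> q) f q = (\<Sum>i\<in>UNIV. \<theta> q $ i * dir_deriv (axis i 1) f q)" for \<theta> q
    by (rule dir_deriv_expand[OF smooth_differentiable[OF f]])
  have main: "dir_deriv u (\<lambda>q. dir_deriv (\<theta> q) f q) p
      = (\<Sum>i\<in>UNIV. \<theta> p $ i * dir_deriv u (dir_deriv (axis i 1) f) p) + dir_deriv (vec_deriv u \<theta> p) f p"
    if "smooth_vec \<theta>" for \<theta>
  proof -
    have "dir_deriv u (\<lambda>q. dir_deriv (\<theta> q) f q) p = (\<Sum>i\<in>UNIV. dir_deriv u (\<lambda>q. \<theta> q $ i * dir_deriv (axis i 1) f q) p)"
      using that f
      by (subst ext[OF ex], intro dir_deriv_sum smooth_differentiable smooth_mult smooth_dir_deriv) (auto simp: smooth_vec_def)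
    also have "\<dots> = (\<Sum>i\<in>UNIV. \<theta> p $ i * dir_deriv u (dir_deriv (axis i 1) f) p
        + dir_deriv u (\<lambda>q. \<theta> q $ i) p * dir_deriv (axis i 1) f p)"
      using that f by (simp add: dir_deriv_mult smooth_vec_differentiable smooth_differentiable smooth_dir_deriv)
    also have "\<dots> = (\<Sum>i\<in>UNIV. \<theta> p $ i * dir_deriv u (dir_deriv (axis i 1) f) p)
        + (\<Sum>i\<in>UNIV. vec_deriv u \<theta> p $ i * dir_deriv (axis i 1) f p)"
      by (simp add: sum.distrib vec_deriv_def)
    also have "(\<Sum>i\<in>UNIV. vec_deriv u \<theta> p $ i * dir_deriv (axis i 1) f p) = dir_deriv (vec_deriv u \<theta> p) f p"
      by (rule dir_deriv_expand[OF smooth_differentiable[OF f], symmetric])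
    finally show ?thesis .
  qed
  have "dir_deriv 0 f p = 0" by (rule linear_0[OF dir_deriv_linear[OF smooth_differentiable[OF f]]])
  then show ?thesis
    using main[OF \<eta>] main[of "\<lambda>q. \<eta> p"] by simp
qed

lemma lie_bracket_field_of:
  assumes "smooth_vec \<xi>" "smooth_vec \<eta>"
  shows "lie_bracket (field_of \<xi>) (field_of \<eta>) = field_of (\<lambda>p. vec_deriv (\<xi> p) \<eta> p - vec_deriv (\<eta> p) \<xi> p)"
proof (intro ext)
  fix p f
  show "lie_bracket (field_of \<xi>) (field_of \<eta>) p f = field_of (\<lambda>p. vec_deriv (\<xi> p) \<eta> p - vec_deriv (\<eta> p) \<xi> p) p f"
  proof (cases "smooth_on UNIV f")
    case True
    have "lie_bracket (field_of \<xi>) (field_of \<eta>) p f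
        = dir_deriv (\<xi> p) (\<lambda>q. dir_deriv (\<eta> q) f q) p - dir_deriv (\<eta> p) (\<lambda>q. dir_deriv (\<xi> q) f q) p"
      by (simp add: lie_bracket_def field_of_apply True smooth_dir_deriv_field assms)
    also have "\<dots> = dir_deriv (vec_deriv (\<xi> p) \<eta> p) f p - dir_deriv (vec_deriv (\<eta> p) \<xi> p) f p"
      using dir_deriv_commute[OF True, of "\<xi> p" "\<eta> p" p]
      unfolding dir_deriv_dir_deriv_field[OF assms(1) True] dir_deriv_dir_deriv_field[OF assms(2) True] by simp
    finally show ?thesis
      by (simp add: field_of_apply True linear_diff[OF dir_deriv_linear[OF smooth_differentiable]])
  next
    case False
    then show ?thesis
      by (simp add: lie_bracket_def field_of_apply_nonsmooth field_of_apply)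
  qed
qed

lemma vec_deriv_vec_deriv_field:
  assumes "smooth_vec \<eta>" "smooth_vec \<zeta>"
  shows "vec_deriv u (\<lambda>q. vec_deriv (\<eta> q) \<zeta> q) p = vec_deriv (vec_deriv u \<eta> p) \<zeta> p + vec_deriv u (vec_deriv (\<eta> p) \<zeta>) p"
  using assms(2) dir_deriv_dir_deriv_field[OF assms(1)] by (simp add: vec_deriv_def Finite_Cartesian_Product.vec_eq_iff smooth_vec_def)

lemma vec_deriv_commute:
  assumes "smooth_vec \<zeta>"
  shows "vec_deriv u (vec_deriv v \<zeta>) p = vec_deriv v (vec_deriv u \<zeta>) p"
  using assms dir_deriv_commute[of _ u v p] by (simp add: vec_deriv_def Finite_Cartesian_Product.vec_eq_iff smooth_vec_def)

section \<open>Connections given by Christoffel symbols\<close>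

lemma bilinear_expand:
  assumes "bilinear (B :: real^'m \<Rightarrow> real^'m \<Rightarrow> 'v::real_vector)"
  shows "B u v = (\<Sum>j\<in>UNIV. \<Sum>k\<in>UNIV. (u $ j * v $ k) *\<^sub>R B (axis j 1) (axis k 1))"
proof -
  have "B u v = B (\<Sum>j\<in>UNIV. u $ j *\<^sub>R axis j 1) (\<Sum>k\<in>UNIV. v $ k *\<^sub>R axis k 1)"
    using vec_expand[of u] vec_expand[of v] by simp
  also have "\<dots> = (\<Sum>(j, k)\<in>UNIV \<times> UNIV. B (u $ j *\<^sub>R axis j 1) (v $ k *\<^sub>R axis k 1))"
    by (rule bilinear_sum[OF assms])
  also have "\<dots> = (\<Sum>j\<in>UNIV. \<Sum>k\<in>UNIV. (u $ j * v $ k) *\<^sub>R B (axis j 1) (axis k 1))"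
    by (simp add: sum.cartesian_product bilinear_lmul[OF assms] bilinear_rmul[OF assms] mult.commute del: UNIV_Times_UNIV)
  finally show ?thesis .
qed

text \<open>The Christoffel symbols at a point are kept together as a bilinear map, which makes the formula
  for the curvature free of indices.\<close>

locale christoffel =
  fixes \<Gamma> :: "real^'m \<Rightarrow> real^'m \<Rightarrow> real^'m \<Rightarrow> real^'m"
  assumes bilinear: "bilinear (\<Gamma> p)"
    and symmetric: "\<Gamma> p u v = \<Gamma> p v u"
    and smooth: "smooth_vec (\<lambda>p. \<Gamma> p u v)"
begin

lemma smooth_vec_\<Gamma>:
  assumes "smooth_vec \<eta>" "smooth_vec \<zeta>"
  shows "smooth_vec (\<lambda>p. \<Gamma> p (\<eta> p) (\<zeta> p))"
  unfolding bilinear_expand[OF bilinear, of _ "\<eta> _" "\<zeta> _"]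
  using assms by (intro smooth_vec_sum smooth_vec_scale smooth_mult smooth) (auto simp: smooth_vec_def)

definition d\<Gamma> :: "real^'m \<Rightarrow> real^'m \<Rightarrow> real^'m \<Rightarrow> real^'m \<Rightarrow> real^'m"
  where "d\<Gamma> p u v w = vec_deriv u (\<lambda>q. \<Gamma> q v w) p"

lemma vec_deriv_\<Gamma>:
  assumes \<eta>: "smooth_vec \<eta>" and \<zeta>: "smooth_vec \<zeta>"
  shows "vec_deriv u (\<lambda>q. \<Gamma> q (\<eta> q) (\<zeta> q)) p
    = d\<Gamma> p u (\<eta> p) (\<zeta> p) + \<Gamma> p (vec_deriv u \<eta> p) (\<zeta> p) + \<Gamma> p (\<eta> p) (vec_deriv u \<zeta> p)"
proof -
  define G where "G j k q = \<Gamma> q (axis j 1) (axis k 1)" for j k q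
  have sG: "smooth_vec (G j k)" for j k unfolding G_def by (rule smooth)
  have ex: "\<Gamma> q v w = (\<Sum>j\<in>UNIV. \<Sum>k\<in>UNIV. (v $ j * w $ k) *\<^sub>R G j k q)" for q v w
    unfolding G_def by (rule bilinear_expand[OF bilinear])
  have main: "vec_deriv u (\<lambda>q. \<Gamma> q (\<theta> q) (\<rho> q)) p
      = (\<Sum>j\<in>UNIV. \<Sum>k\<in>UNIV. (\<theta> p $ j * \<rho> p $ k) *\<^sub>R vec_deriv u (G j k) p)
        + \<Gamma> p (vec_deriv u \<theta> p) (\<rho> p) + \<Gamma> p (\<theta> p) (vec_deriv u \<rho> p)"
    if \<theta>: "smooth_vec \<theta>" and \<rho>: "smooth_vec \<rho>" for \<theta> \<rho>
  proof -
    have s: "smooth_on UNIV (\<lambda>q. \<theta> q $ j)" "smooth_on UNIV (\<lambda>q. \<rho> q $ j)" for j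
      using \<theta> \<rho> by (auto simp: smooth_vec_def)
    have tm: "vec_deriv u (\<lambda>q. (\<theta> q $ j * \<rho> q $ k) *\<^sub>R G j k q) p
        = (\<theta> p $ j * \<rho> p $ k) *\<^sub>R vec_deriv u (G j k) p
          + (vec_deriv u \<theta> p $ j * \<rho> p $ k) *\<^sub>R G j k p + (\<theta> p $ j * vec_deriv u \<rho> p $ k) *\<^sub>R G j k p" for j k
      unfolding vec_deriv_scale[OF smooth_mult[OF s] sG]
        dir_deriv_mult[OF smooth_differentiable[OF s(1)] smooth_differentiable[OF s(2)]]
      by (simp add: vec_deriv_def scaleR_add_left)
    have "vec_deriv u (\<lambda>q. \<Gamma> q (\<theta> q) (\<rho> q)) p
        = (\<Sum>j\<in>UNIV. \<Sum>k\<in>UNIV. vec_deriv u (\<lambda>q. (\<theta> q $ j * \<rho> q $ k) *\<^sub>R G j k q) p)"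
      unfolding ex using s sG by (simp add: vec_deriv_sum smooth_vec_sum smooth_vec_scale smooth_mult)
    then show ?thesis
      unfolding tm ex[of p "vec_deriv u \<theta> p"] ex[of p "\<theta> p" "vec_deriv u \<rho> p"] by (simp add: sum.distrib)
  qed
  show ?thesis
    using main[OF \<eta> \<zeta>] main[of "\<lambda>_. \<eta> p" "\<lambda>_. \<zeta> p"]
    by (simp add: d\<Gamma>_def bilinear_lzero[OF bilinear] bilinear_rzero[OF bilinear])
qed

definition cov_deriv :: "(real^'m \<Rightarrow> real^'m) \<Rightarrow> (real^'m \<Rightarrow> real^'m) \<Rightarrow> real^'m \<Rightarrow> real^'m"
  where "cov_deriv \<xi> \<eta> p = vec_deriv (\<xi> p) \<eta> p + \<Gamma> p (\<xi> p) (\<eta> p)"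

lemma smooth_vec_cov_deriv: "smooth_vec \<xi> \<Longrightarrow> smooth_vec \<eta> \<Longrightarrow> smooth_vec (cov_deriv \<xi> \<eta>)"
  unfolding cov_deriv_def[abs_def] by (intro smooth_vec_add smooth_vec_vec_deriv smooth_vec_\<Gamma>)

definition conn :: "(real^'m) connection"
  where "conn X Y = field_of (cov_deriv (\<lambda>p. components (X p)) (\<lambda>p. components (Y p)))"

lemma conn_field_of [simp]: "conn (field_of \<xi>) (field_of \<eta>) = field_of (cov_deriv \<xi> \<eta>)"
  by (simp add: conn_def field_of_def)

lemma cov_deriv_add_left:
  "smooth_vec \<eta> \<Longrightarrow> cov_deriv (\<lambda>p. \<xi> p + \<xi>' p) \<eta> = (\<lambda>p. cov_deriv \<xi> \<eta> p + cov_deriv \<xi>' \<eta> p)"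
  by (rule ext) (simp add: cov_deriv_def linear_add[OF linear_vec_deriv] bilinear_ladd[OF bilinear])

lemma cov_deriv_scale_left:
  "smooth_vec \<eta> \<Longrightarrow> cov_deriv (\<lambda>p. f p *\<^sub>R \<xi> p) \<eta> = (\<lambda>p. f p *\<^sub>R cov_deriv \<xi> \<eta> p)"
  by (rule ext)
    (simp add: cov_deriv_def linear_scale[OF linear_vec_deriv] bilinear_lmul[OF bilinear] scaleR_add_right)

lemma cov_deriv_add_right:
  "smooth_vec \<eta> \<Longrightarrow> smooth_vec \<eta>' \<Longrightarrow>
    cov_deriv \<xi> (\<lambda>p. \<eta> p + \<eta>' p) = (\<lambda>p. cov_deriv \<xi> \<eta> p + cov_deriv \<xi> \<eta>' p)"
  by (rule ext) (simp add: cov_deriv_def vec_deriv_add bilinear_radd[OF bilinear])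

lemma cov_deriv_scale_right:
  "smooth_on UNIV f \<Longrightarrow> smooth_vec \<eta> \<Longrightarrow>
    cov_deriv \<xi> (\<lambda>p. f p *\<^sub>R \<eta> p) = (\<lambda>p. dir_deriv (\<xi> p) f p *\<^sub>R \<eta> p + f p *\<^sub>R cov_deriv \<xi> \<eta> p)"
  by (rule ext) (simp add: cov_deriv_def vec_deriv_scale bilinear_rmul[OF bilinear] scaleR_add_right)

lemma is_connection_conn: "is_connection euclidean std_atlas conn"
  unfolding is_connection_def vector_fields_std smooth_functions_std
  by (auto simp: field_of_add field_of_scale field_of_apply smooth_vec_cov_deriv
      cov_deriv_add_left cov_deriv_scale_left cov_deriv_add_right cov_deriv_scale_right)

lemma torsion_free_conn: "torsion_free euclidean std_atlas conn"
proof -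
  have "(\<lambda>p. cov_deriv \<xi> \<eta> p - cov_deriv \<eta> \<xi> p) = (\<lambda>p. vec_deriv (\<xi> p) \<eta> p - vec_deriv (\<eta> p) \<xi> p)" for \<xi> \<eta>
    by (rule ext) (simp add: cov_deriv_def symmetric[of _ "\<xi> _" "\<eta> _"])
  then show ?thesis
    unfolding torsion_free_def vector_fields_std by (auto simp: lie_bracket_field_of field_of_diff)
qed

definition curv :: "real^'m \<Rightarrow> real^'m \<Rightarrow> real^'m \<Rightarrow> real^'m \<Rightarrow> real^'m"
  where "curv p u v w = d\<Gamma> p u v w - d\<Gamma> p v u w + \<Gamma> p u (\<Gamma> p v w) - \<Gamma> p v (\<Gamma> p u w)"

lemma cov_deriv_cov_deriv:
  assumes "smooth_vec \<xi>" "smooth_vec \<eta>" "smooth_vec \<zeta>"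
  shows "cov_deriv \<xi> (cov_deriv \<eta> \<zeta>) p = vec_deriv (vec_deriv (\<xi> p) \<eta> p) \<zeta> p + vec_deriv (\<xi> p) (vec_deriv (\<eta> p) \<zeta>) p
    + d\<Gamma> p (\<xi> p) (\<eta> p) (\<zeta> p) + \<Gamma> p (vec_deriv (\<xi> p) \<eta> p) (\<zeta> p) + \<Gamma> p (\<eta> p) (vec_deriv (\<xi> p) \<zeta> p)
    + \<Gamma> p (\<xi> p) (vec_deriv (\<eta> p) \<zeta> p) + \<Gamma> p (\<xi> p) (\<Gamma> p (\<eta> p) (\<zeta> p))"
proof -
  have "vec_deriv u (cov_deriv \<eta> \<zeta>) p = vec_deriv u (\<lambda>q. vec_deriv (\<eta> q) \<zeta> q) p + vec_deriv u (\<lambda>q. \<Gamma> q (\<eta> q) (\<zeta> q)) p" for u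
    unfolding cov_deriv_def[abs_def] using assms by (intro vec_deriv_add smooth_vec_vec_deriv smooth_vec_\<Gamma>)
  then show ?thesis
    unfolding cov_deriv_def[of \<xi>] vec_deriv_vec_deriv_field[OF assms(2,3)] vec_deriv_\<Gamma>[OF assms(2,3)]
    by (simp add: cov_deriv_def bilinear_radd[OF bilinear] add.assoc)
qed

text \<open>In the commutator of covariant derivatives the second derivatives of \<open>\<zeta>\<close> cancel by symmetry, its first
  derivatives inside \<open>\<Gamma>\<close> cancel in pairs, and all terms with derivatives of \<open>\<xi>\<close> or \<open>\<eta>\<close> are absorbed by the Lie bracket. What is left depends
  only on the values at the point.\<close>

lemma curvature_field_of:
  assumes "smooth_vec \<xi>" "smooth_vec \<eta>" "smooth_vec \<zeta>"
  shows "curvature conn (field_of \<xi>) (field_of \<eta>) (field_of \<zeta>) p = tangent_vec p (curv p (\<xi> p) (\<eta> p) (\<zeta> p))"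
proof -
  let ?L = "\<lambda>p. vec_deriv (\<xi> p) \<eta> p - vec_deriv (\<eta> p) \<xi> p"
  have "curvature conn (field_of \<xi>) (field_of \<eta>) (field_of \<zeta>)
      = field_of (\<lambda>p. cov_deriv \<xi> (cov_deriv \<eta> \<zeta>) p - cov_deriv \<eta> (cov_deriv \<xi> \<zeta>) p - cov_deriv ?L \<zeta> p)"
    unfolding curvature_def lie_bracket_field_of[OF assms(1,2)] conn_field_of field_of_diff ..
  moreover have "cov_deriv \<xi> (cov_deriv \<eta> \<zeta>) p - cov_deriv \<eta> (cov_deriv \<xi> \<zeta>) p - cov_deriv ?L \<zeta> p
      = curv p (\<xi> p) (\<eta> p) (\<zeta> p)"
    unfolding cov_deriv_cov_deriv[OF assms] cov_deriv_cov_deriv[OF assms(2,1,3)] cov_deriv_def[of ?L] curv_def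
    using vec_deriv_commute[OF assms(3), of "\<xi> p" "\<eta> p" p]
    by (simp add: linear_diff[OF linear_vec_deriv[OF assms(3)]] bilinear_lsub[OF bilinear] algebra_simps)
  ultimately show ?thesis by (simp add: field_of_def)
qed

lemma curvature_at_conn:
  "curvature_at euclidean std_atlas conn p (tangent_vec p u) (tangent_vec p v) (tangent_vec p w) = tangent_vec p (curv p u v w)"
  unfolding curvature_at_def
proof (intro the_equality)
  show "\<exists>X\<in>vector_fields euclidean std_atlas. \<exists>Y\<in>vector_fields euclidean std_atlas.
      \<exists>Z\<in>vector_fields euclidean std_atlas. X p = tangent_vec p u \<and> Y p = tangent_vec p v \<and> Z p = tangent_vec p w \<and>
        tangent_vec p (curv p u v w) = curvature conn X Y Z p"
  proof (rule bexI[of _ "field_of (\<lambda>_. u)"], rule bexI[of _ "field_of (\<lambda>_. v)"], rule bexI[of _ "field_of (\<lambda>_. w)"])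
    show "field_of (\<lambda>_. u) p = tangent_vec p u \<and> field_of (\<lambda>_. v) p = tangent_vec p v \<and> field_of (\<lambda>_. w) p = tangent_vec p w \<and>
        tangent_vec p (curv p u v w) = curvature conn (field_of (\<lambda>_. u)) (field_of (\<lambda>_. v)) (field_of (\<lambda>_. w)) p"
      using curvature_field_of[of "\<lambda>_. u" "\<lambda>_. v" "\<lambda>_. w" p] by (simp add: field_of_def)
  qed (simp_all add: field_of_in_vector_fields)
next
  fix x
  assume "\<exists>X\<in>vector_fields euclidean std_atlas. \<exists>Y\<in>vector_fields euclidean std_atlas.
      \<exists>Z\<in>vector_fields euclidean std_atlas. X p = tangent_vec p u \<and> Y p = tangent_vec p v \<and> Z p = tangent_vec p w \<and>
        x = curvature conn X Y Z p"
  then obtain \<xi> \<eta> \<zeta> where s: "smooth_vec \<xi>" "smooth_vec \<eta>" "smooth_vec \<zeta>"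
    and p: "field_of \<xi> p = tangent_vec p u" "field_of \<eta> p = tangent_vec p v" "field_of \<zeta> p = tangent_vec p w"
    and x: "x = curvature conn (field_of \<xi>) (field_of \<eta>) (field_of \<zeta>) p"
    unfolding vector_fields_std by blast
  have "\<xi> p = u" "\<eta> p = v" "\<zeta> p = w"
    using p by (simp_all add: field_of_def inj_eq[OF inj_tangent_vec])
  then show "x = tangent_vec p (curv p u v w)" unfolding x curvature_field_of[OF s] by simp
qed

lemma affine_manifold_conn: "affine_manifold euclidean std_atlas conn"
proof -
  have sc: "second_countable (euclidean :: (real^'m) topology)"
  proof -
    obtain B :: "(real^'m) set set" where B: "countable B" "\<And>C. C \<in> B \<Longrightarrow> open C"
      "\<And>S. open S \<Longrightarrow> \<exists>U. U \<subseteq> B \<and> S = \<Union>U"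
      using univ_second_countable by blast
    have "\<exists>V\<in>B. x \<in> V \<and> V \<subseteq> U" if "open U" "x \<in> U" for U x
      using B(3)[OF that(1)] that(2) by blast
    with B show ?thesis
      unfolding second_countable_def by (intro exI[of _ B]) simp
  qed
  have id: "smooth_on UNIV (id :: real^'m \<Rightarrow> real^'m)"
  proof -
    have c: "Ck_on k UNIV (\<lambda>x::real^'m. c :: real^'m)" for k c
      by (induction k arbitrary: c) simp_all
    have "Ck_on k UNIV (id :: real^'m \<Rightarrow> real^'m)" for k
      using c by (cases k) (simp_all add: id_def)
    then show ?thesis by (simp add: smooth_on_def)
  qed
  show ?thesis
    unfolding affine_manifold_def smooth_manifold_def smooth_atlas_def
    using is_connection_conn torsion_free_conn sc id
    by (auto simp: Hausdorff_space_euclidean homeomorphic_map_id)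
qed

end

section \<open>A family of Osserman curvature tensors\<close>

definition osserman_tensor :: "'m::finite \<Rightarrow> 'm \<Rightarrow> (real^'m \<Rightarrow> real^'m \<Rightarrow> real) \<Rightarrow> real \<Rightarrow>
    real^'m \<Rightarrow> real^'m \<Rightarrow> real^'m \<Rightarrow> real^'m"
  where "osserman_tensor a b h \<epsilon> u v w = h v w *\<^sub>R u - h u w *\<^sub>R v
    - (\<epsilon> * (u $ a * v $ b - u $ b * v $ a)) *\<^sub>R (w $ a *\<^sub>R axis a 1 + w $ b *\<^sub>R axis b 1)"

lemma linear_jacobi_osserman:
  assumes "bilinear h"
  shows "linear (jacobi_operator (osserman_tensor a b h \<epsilon>) v)"
  by (rule linearI)
    (simp_all add: jacobi_operator_def osserman_tensor_def bilinear_ladd[OF assms] bilinear_lmul[OF assms] algebra_simps)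

text \<open>For \<open>J\<close> the Jacobi operator, \<open>l = h(v,v)\<close> and \<open>q = Qv\<close>, one has
  \<open>(J - l) u = - h(u,v) v - d(u) q\<close>, where \<open>d\<close> vanishes at both \<open>v\<close> and \<open>q\<close>. Applying \<open>J - l\<close> again
  leaves a multiple of \<open>v\<close>.\<close>

lemma Spec_jacobi_osserman:
  fixes v :: "real^'m"
  assumes h: "bilinear h" and ab: "a \<noteq> b" and dim: "CARD('m) \<ge> 2" and v: "v \<noteq> 0"
  shows "Spec UNIV (jacobi_operator (osserman_tensor a b h \<epsilon>) v) = {0, complex_of_real (h v v)}"
proof (rule Spec_eq_0_eigenvalue)
  let ?J = "jacobi_operator (osserman_tensor a b h \<epsilon>) v"
  define q where "q = v $ a *\<^sub>R axis a 1 + v $ b *\<^sub>R axis b (1::real)"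
  define d where "d u = \<epsilon> * (u $ a * v $ b - u $ b * v $ a)" for u
  have J: "?J u = h v v *\<^sub>R u - h u v *\<^sub>R v - d u *\<^sub>R q" for u
    by (simp add: jacobi_operator_def osserman_tensor_def q_def d_def)
  have dq: "d q = 0" "d v = 0" using ab by (simp_all add: d_def q_def axis_def)
  show "linear ?J" by (rule linear_jacobi_osserman[OF h])
  then show "?J (?J u) - (2 * h v v) *\<^sub>R ?J u + (h v v)\<^sup>2 *\<^sub>R u
      = (h v v * h u v + h q v * d u) *\<^sub>R v" for u
  proof -
    have Jv: "?J v = 0" by (simp add: J dq)
    have Jq: "?J q = h v v *\<^sub>R q - h q v *\<^sub>R v" by (simp add: J dq)
    have "?J (?J u) = h v v *\<^sub>R ?J u - d u *\<^sub>R ?J q"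
      by (subst (2) J) (simp add: linear_diff[OF \<open>linear ?J\<close>] linear_scale[OF \<open>linear ?J\<close>] Jv)
    then show ?thesis
      unfolding Jq J[of u]
      by (simp add: Finite_Cartesian_Product.vec_eq_iff power2_eq_square algebra_simps)
  qed
  show "linear (\<lambda>u. h v v * h u v + h q v * d u)"
    by (rule linearI) (simp_all add: d_def bilinear_ladd[OF h] bilinear_lmul[OF h] algebra_simps)
  show "?J v = 0" by (simp add: J dq)
qed (use v dim in auto)

definition pos_def_form :: "(real^'m \<Rightarrow> real^'m \<Rightarrow> real) \<Rightarrow> bool"
  where "pos_def_form h \<longleftrightarrow> bilinear h \<and> (\<forall>u v. h u v = h v u) \<and> (\<forall>v. v \<noteq> 0 \<longrightarrow> 0 < h v v)"

lemma osserman_tensor_curvature_model: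
  assumes h: "pos_def_form h" and ab: "a \<noteq> b"
  shows "affine_curvature_model UNIV (osserman_tensor a b h \<epsilon>)"
proof -
  have b: "bilinear h" and sym: "h u v = h v u" for u v
    using h by (auto simp: pos_def_form_def)
  note bl = bilinear_ladd[OF b] bilinear_lmul[OF b] bilinear_radd[OF b] bilinear_rmul[OF b]
  have "osserman_tensor a b h \<epsilon> x y z + osserman_tensor a b h \<epsilon> y z x + osserman_tensor a b h \<epsilon> z x y = 0" for x y z
    using ab
    by (simp add: Finite_Cartesian_Product.vec_eq_iff osserman_tensor_def axis_def sym[of y x] sym[of z x] sym[of z y])
      (simp add: algebra_simps)
  then show ?thesis
    unfolding affine_curvature_model_def linear_within_def
    by (auto simp: finite_dim_space_UNIV osserman_tensor_def bl algebra_simps)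
qed

lemma two_point_spectra_proportional:
  assumes "0 < (l::real)" "0 < l'" "S = {0, complex_of_real l}" "S' = {0, complex_of_real l'}"
  shows "\<exists>s::real. s \<noteq> 0 \<and> S' = (\<lambda>z. complex_of_real s * z) ` S \<and> (\<lambda>z. complex_of_real s * z) ` S \<noteq> {0}"
proof (intro exI[of _ "l' / l"] conjI)
  show "l' / l \<noteq> 0" using assms by simp
  show eq: "S' = (\<lambda>z. complex_of_real (l' / l) * z) ` S"
    using assms(1) unfolding assms(3,4) by simp
  then show "(\<lambda>z. complex_of_real (l' / l) * z) ` S \<noteq> {0}"
    using assms(2,4) by (metis insertI1 insertI2 less_irrefl of_real_eq_0_iff singletonD)
qed

lemma osserman_tensor_Osserman_model:
  fixes h :: "real^'m \<Rightarrow> real^'m \<Rightarrow> real"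
  assumes h: "pos_def_form h" and ab: "a \<noteq> b" and dim: "CARD('m) \<ge> 2"
  shows "affine_projective_Osserman_model UNIV (osserman_tensor a b h \<epsilon>)"
  unfolding affine_projective_Osserman_model_def
proof (intro conjI ballI)
  show "affine_curvature_model UNIV (osserman_tensor a b h \<epsilon>)" by (rule osserman_tensor_curvature_model[OF h ab])
next
  have b: "bilinear h" and pos: "0 < h v v" if "v \<noteq> 0" for v
    using that h by (auto simp: pos_def_form_def)
  fix v w :: "real^'m" assume "v \<in> UNIV - {0}" "w \<in> UNIV - {0}"
  then have "v \<noteq> 0" "w \<noteq> 0" by auto
  then show "\<exists>s. s \<noteq> 0 \<and> Spec UNIV (jacobi_operator (osserman_tensor a b h \<epsilon>) v)
        = (\<lambda>z. complex_of_real s * z) ` Spec UNIV (jacobi_operator (osserman_tensor a b h \<epsilon>) w) \<and>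
      (\<lambda>z. complex_of_real s * z) ` Spec UNIV (jacobi_operator (osserman_tensor a b h \<epsilon>) w) \<noteq> {0}"
    by (intro two_point_spectra_proportional[of "h w w" "h v v"] Spec_jacobi_osserman pos b ab dim)
qed

text \<open>The form \<open>h\<close> and the coefficient \<open>e\<close> may vary from point to point, as the condition on a pair of tangent
  vectors only compares \<open>{0, h(u,u)}\<close> with \<open>{0, h(v,v)}\<close> up to a factor.\<close>

lemma (in christoffel) Osserman_manifold_of_osserman_tensor:
  assumes curv: "\<And>p. curv p = osserman_tensor a b (h p) (e p)" and h: "\<And>p. pos_def_form (h p)"
    and ab: "a \<noteq> b" and dim: "CARD('m) \<ge> 2"
  shows "affine_projective_Osserman_manifold euclidean std_atlas conn"
  unfolding affine_projective_Osserman_manifold_def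
proof (intro conjI ballI)
  show "affine_manifold euclidean std_atlas conn" by (rule affine_manifold_conn)
next
  have b: "bilinear (h p)" and pos: "v \<noteq> 0 \<Longrightarrow> 0 < h p v v" for p v
    using h[of p] by (auto simp: pos_def_form_def)
  have spec: "Spec (tangent_space euclidean std_atlas p)
      (jacobi_operator (curvature_at euclidean std_atlas conn p) (tangent_vec p v)) = {0, complex_of_real (h p v v)}"
    if "v \<noteq> 0" for p v
  proof -
    have "Spec (range (tangent_vec p)) (jacobi_operator (curvature_at euclidean std_atlas conn p) (tangent_vec p v))
        = Spec UNIV (jacobi_operator (osserman_tensor a b (h p) (e p)) v)"
      by (rule Spec_range[OF linear_tangent_vec inj_tangent_vec linear_jacobi_osserman[OF b]])
        (simp add: jacobi_operator_def curvature_at_conn curv)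
    then show ?thesis
      using Spec_jacobi_osserman[OF b ab dim that] by (simp add: tangent_space_std)
  qed
  fix p q :: "real^'m" and x y
  assume "x \<in> tangent_space euclidean std_atlas p - {0}" "y \<in> tangent_space euclidean std_atlas q - {0}"
  then obtain u v where "x = tangent_vec p u" "y = tangent_vec q v" "tangent_vec p u \<noteq> 0" "tangent_vec q v \<noteq> 0"
    by (auto simp: tangent_space_std)
  moreover from this have "u \<noteq> 0" "v \<noteq> 0"
    using linear_0[OF linear_tangent_vec] by metis+
  ultimately show "let Sx = Spec (tangent_space euclidean std_atlas p) (jacobi_operator (curvature_at euclidean std_atlas conn p) x);
          Sy = Spec (tangent_space euclidean std_atlas q) (jacobi_operator (curvature_at euclidean std_atlas conn q) y)
      in \<exists>s::real. s \<noteq> 0 \<and> Sy = (\<lambda>z. complex_of_real s * z) ` Sx \<and>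
           (\<lambda>z. complex_of_real s * z) ` Sx \<noteq> {0}"
    unfolding Let_def by (intro two_point_spectra_proportional[of "h p u u" "h q v v"]) (simp_all add: spec pos)
qed

lemma (in christoffel) realizable_at:
  assumes "curv p = A"
  shows "geometrically_realizable_by UNIV A euclidean std_atlas conn"
  unfolding geometrically_realizable_by_def isomorphic_models_def
proof (intro bexI[of _ p] exI[of _ "tangent_vec p"] conjI ballI)
  show "bij_betw (tangent_vec p) UNIV (tangent_space euclidean std_atlas p)"
    by (simp add: tangent_space_std bij_betw_def inj_tangent_vec)
qed (simp_all add: linear_tangent_vec curvature_at_conn assms)

section \<open>A connection with Osserman curvature at every point\<close>

text \<open>The one-form \<open>\<alpha> = - \<Sum>\<^sub>i sinh (\<kappa> p\<^sub>i) / \<kappa> dp\<^sub>i\<close>. To first order at the origin it is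
  \<open>- \<Sum>\<^sub>i p\<^sub>i dp\<^sub>i\<close>, whose negative derivative is the Euclidean inner product.\<close>

definition sinh_form :: "real \<Rightarrow> real^'m \<Rightarrow> real^'m \<Rightarrow> real"
  where "sinh_form \<kappa> p u = - (\<Sum>i\<in>UNIV. sinh (\<kappa> * p $ i) / \<kappa> * u $ i)"

text \<open>The last two terms are the plane connection with skew-symmetric Ricci tensor and potential
  \<open>\<phi> = - \<epsilon> sin p\<^sub>a sin p\<^sub>b\<close>: the coefficients are \<open>- \<partial>\<^sub>a \<phi>\<close> and \<open>\<partial>\<^sub>b \<phi>\<close>.\<close>

definition osserman_symbols :: "'m::finite \<Rightarrow> 'm \<Rightarrow> real \<Rightarrow> real \<Rightarrow> real^'m \<Rightarrow> real^'m \<Rightarrow> real^'m \<Rightarrow> real^'m"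
  where "osserman_symbols a b \<epsilon> \<kappa> p u v = sinh_form \<kappa> p u *\<^sub>R v + sinh_form \<kappa> p v *\<^sub>R u
    + (\<epsilon> * (cos (p $ a) * sin (p $ b)) * (u $ a * v $ a)) *\<^sub>R axis a 1
    - (\<epsilon> * (sin (p $ a) * cos (p $ b)) * (u $ b * v $ b)) *\<^sub>R axis b 1"

lemma sinh_form_linear:
  "sinh_form \<kappa> p (u + v) = sinh_form \<kappa> p u + sinh_form \<kappa> p v"
  "sinh_form \<kappa> p (u - v) = sinh_form \<kappa> p u - sinh_form \<kappa> p v"
  "sinh_form \<kappa> p (c *\<^sub>R u) = c * sinh_form \<kappa> p u"
  by (simp_all add: sinh_form_def algebra_simps sum.distrib sum_subtractf sum_distrib_left
      add_divide_distrib diff_divide_distrib)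

lemma sinh_form_axis: "sinh_form \<kappa> p (axis a 1) = - (sinh (\<kappa> * p $ a) / \<kappa>)"
  by (simp add: sinh_form_def axis_def if_distrib cong: if_cong)

lemma smooth_sinh_form:
  fixes u :: "real^'m"
  shows "smooth_on UNIV (\<lambda>p. sinh_form \<kappa> p u)"
proof -
  have "smooth_on UNIV (\<lambda>p::real^'m. \<Sum>i\<in>UNIV. - (u $ i) / \<kappa> * sinh (\<kappa> * p $ i))"
    by (intro smooth_sum smooth_mult smooth_const smooth_sinh_component)
  moreover have "sinh_form \<kappa> p u = (\<Sum>i\<in>UNIV. - (u $ i) / \<kappa> * sinh (\<kappa> * p $ i))" for p
    by (simp add: sinh_form_def sum_negf[symmetric] mult.commute)
  ultimately show ?thesis by simp
qed

lemma christoffel_osserman_symbols: "christoffel (osserman_symbols a b \<epsilon> \<kappa>)"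
proof
  show "bilinear (osserman_symbols a b \<epsilon> \<kappa> p)" for p
    unfolding bilinear_def
    by (auto intro!: linearI simp: osserman_symbols_def sinh_form_linear algebra_simps)
  show "osserman_symbols a b \<epsilon> \<kappa> p u v = osserman_symbols a b \<epsilon> \<kappa> p v u" for p u v
    by (simp add: osserman_symbols_def mult.commute)
  show "smooth_vec (\<lambda>p. osserman_symbols a b \<epsilon> \<kappa> p u v)" for u v
    unfolding osserman_symbols_def
    by (intro smooth_vec_add smooth_vec_diff smooth_vec_scale smooth_vec_const smooth_sinh_form
        smooth_mult smooth_const smooth_sin_component smooth_cos_component)
qed

lemma vec_deriv_eqI:
  assumes "(F has_derivative F') (at p)"
  shows "vec_deriv u F p = F' u"
proof -
  have "((\<lambda>q. F q $ i) has_derivative (\<lambda>u. F' u $ i)) (at p)" for i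
    using bounded_linear.has_derivative[OF bounded_linear_vec_nth assms] .
  then have "dir_deriv u (\<lambda>q. F q $ i) p = F' u $ i" for i by (rule dir_deriv_eqI)
  then show ?thesis by (simp add: Finite_Cartesian_Product.vec_eq_iff vec_deriv_def)
qed

text \<open>The negative of the derivative of \<open>sinh_form\<close>. Its symmetry expresses that \<open>sinh_form\<close> is closed.\<close>

definition cosh_form :: "real \<Rightarrow> real^'m \<Rightarrow> real^'m \<Rightarrow> real^'m \<Rightarrow> real"
  where "cosh_form \<kappa> p u v = (\<Sum>i\<in>UNIV. cosh (\<kappa> * p $ i) * u $ i * v $ i)"

lemma has_derivative_sinh_form:
  fixes v :: "real^'m"
  assumes "\<kappa> \<noteq> 0"
  shows "((\<lambda>q. sinh_form \<kappa> q v) has_derivative (\<lambda>u. - cosh_form \<kappa> p u v)) (at p)"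
proof -
  have "((\<lambda>q::real^'m. sinh (\<kappa> * q $ i) / \<kappa>) has_derivative (\<lambda>u. cosh (\<kappa> * p $ i) * u $ i)) (at p)" for i
    by (rule has_derivative_comp_component) (use assms in \<open>auto intro!: derivative_eq_intros\<close>)
  then show ?thesis
    unfolding sinh_form_def cosh_form_def
    by (intro has_derivative_minus has_derivative_sum has_derivative_mult_left)
qed

lemma vec_deriv_osserman_symbols:
  fixes p :: "real^'m"
  assumes "\<kappa> \<noteq> 0"
  shows "vec_deriv u (\<lambda>q. osserman_symbols a b \<epsilon> \<kappa> q v w) p
    = - (cosh_form \<kappa> p u v *\<^sub>R w) - cosh_form \<kappa> p u w *\<^sub>R v
      + (\<epsilon> * (cos (p $ a) * cos (p $ b) * u $ b - sin (p $ a) * sin (p $ b) * u $ a) * (v $ a * w $ a)) *\<^sub>R axis a 1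
      - (\<epsilon> * (cos (p $ a) * cos (p $ b) * u $ a - sin (p $ a) * sin (p $ b) * u $ b) * (v $ b * w $ b)) *\<^sub>R axis b 1"
proof -
  have s: "((\<lambda>q::real^'m. sin (q $ i)) has_derivative (\<lambda>u. cos (p $ i) * u $ i)) (at p)"
    and c: "((\<lambda>q::real^'m. cos (q $ i)) has_derivative (\<lambda>u. - sin (p $ i) * u $ i)) (at p)" for i
    by (rule has_derivative_comp_component; auto intro!: derivative_eq_intros)+
  note mult_const = has_derivative_mult_left[OF has_derivative_mult_right]
  have "((\<lambda>q. osserman_symbols a b \<epsilon> \<kappa> q v w) has_derivative (\<lambda>u.
      (- cosh_form \<kappa> p u v) *\<^sub>R w + (- cosh_form \<kappa> p u w) *\<^sub>R v
      + (\<epsilon> * (cos (p $ a) * (cos (p $ b) * u $ b) + (- sin (p $ a) * u $ a) * sin (p $ b)) * (v $ a * w $ a)) *\<^sub>R axis a 1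
      - (\<epsilon> * (sin (p $ a) * (- sin (p $ b) * u $ b) + (cos (p $ a) * u $ a) * cos (p $ b)) * (v $ b * w $ b)) *\<^sub>R axis b 1)) (at p)"
    unfolding osserman_symbols_def
    by (intro has_derivative_add has_derivative_diff has_derivative_scaleR_left mult_const
        has_derivative_sinh_form assms has_derivative_mult s c)
  from vec_deriv_eqI[OF this, of u] show ?thesis by (simp add: algebra_simps)
qed

text \<open>This is \<open>- (D\<^sub>u \<alpha>)(v) + \<alpha>(u) \<alpha>(v) + \<alpha>(S(u,v))\<close>, with the last summand written out.\<close>

definition osserman_form :: "'m::finite \<Rightarrow> 'm \<Rightarrow> real \<Rightarrow> real \<Rightarrow> real^'m \<Rightarrow> real^'m \<Rightarrow> real^'m \<Rightarrow> real"
  where "osserman_form a b \<epsilon> \<kappa> p u v = cosh_form \<kappa> p u v + sinh_form \<kappa> p u * sinh_form \<kappa> p v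
    - (\<epsilon> * (cos (p $ a) * sin (p $ b)) * (u $ a * v $ a)) * (sinh (\<kappa> * p $ a) / \<kappa>)
    + (\<epsilon> * (sin (p $ a) * cos (p $ b)) * (u $ b * v $ b)) * (sinh (\<kappa> * p $ b) / \<kappa>)"

text \<open>The quadratic terms contribute \<open>\<alpha>(v) \<alpha>(w) + \<alpha>(S(v,w))\<close> to \<open>h(v,w)\<close>, and \<open>S(u,S(v,w))\<close> is
  symmetric in all its arguments and drops out. The \<open>Qw\<close> part comes from the derivatives of \<open>S\<close> alone: with
  \<open>e = \<epsilon> cos p\<^sub>a cos p\<^sub>b\<close>, the coefficient of \<open>S\<close> at \<open>a\<close> has derivative \<open>e\<close> in direction \<open>b\<close>, and that at \<open>b\<close>
  has derivative \<open>- e\<close> in direction \<open>a\<close>, so that the two components of \<open>Qw\<close> get the same factor.\<close>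

lemma curv_osserman_symbols:
  fixes p :: "real^'m"
  assumes "\<kappa> \<noteq> 0" "a \<noteq> b"
  shows "christoffel.curv (osserman_symbols a b \<epsilon> \<kappa>) p = osserman_tensor a b (osserman_form a b \<epsilon> \<kappa> p) (\<epsilon> * cos (p $ a) * cos (p $ b))"
proof (intro ext)
  fix u v w :: "real^'m"
  interpret christoffel "osserman_symbols a b \<epsilon> \<kappa>" by (rule christoffel_osserman_symbols)
  define ca sa cb sb where "ca = cos (p $ a)" "sa = sin (p $ a)" "cb = cos (p $ b)" "sb = sin (p $ b)"
  define A B where "A = \<epsilon> * (ca * sb)" and "B = \<epsilon> * (sa * cb)"
  define \<alpha> \<beta> where "\<alpha> = sinh_form \<kappa> p" and "\<beta> = cosh_form \<kappa> p"
  have \<beta>: "\<beta> x y = \<beta> y x" for x y by (simp add: \<beta>_def cosh_form_def mult.commute mult.left_commute)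
  have \<alpha>: "\<alpha> (x + y) = \<alpha> x + \<alpha> y" "\<alpha> (x - y) = \<alpha> x - \<alpha> y" "\<alpha> (c *\<^sub>R x) = c * \<alpha> x" for x y c
    by (simp_all add: \<alpha>_def sinh_form_linear)
  have G: "osserman_symbols a b \<epsilon> \<kappa> p x y = \<alpha> x *\<^sub>R y + \<alpha> y *\<^sub>R x + (A * (x $ a * y $ a)) *\<^sub>R axis a 1
      - (B * (x $ b * y $ b)) *\<^sub>R axis b 1" for x y
    by (simp add: osserman_symbols_def \<alpha>_def A_def B_def ca_sa_cb_sb_def)
  have H: "osserman_form a b \<epsilon> \<kappa> p x y = \<beta> x y + \<alpha> x * \<alpha> y + A * (x $ a * y $ a) * \<alpha> (axis a 1)
      - B * (x $ b * y $ b) * \<alpha> (axis b 1)" for x y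
    by (simp add: osserman_form_def \<alpha>_def \<beta>_def A_def B_def ca_sa_cb_sb_def sinh_form_axis)
  have D: "d\<Gamma> p x y z = - (\<beta> x y *\<^sub>R z) - \<beta> x z *\<^sub>R y
      + (\<epsilon> * (ca * cb * x $ b - sa * sb * x $ a) * (y $ a * z $ a)) *\<^sub>R axis a 1
      - (\<epsilon> * (ca * cb * x $ a - sa * sb * x $ b) * (y $ b * z $ b)) *\<^sub>R axis b 1" for x y z
    unfolding d\<Gamma>_def vec_deriv_osserman_symbols[OF assms(1)] by (simp add: \<beta>_def ca_sa_cb_sb_def)
  have e: "\<epsilon> * cos (p $ a) * cos (p $ b) = \<epsilon> * ca * cb" by (simp add: ca_sa_cb_sb_def)
  show "curv p u v w = osserman_tensor a b (osserman_form a b \<epsilon> \<kappa> p) (\<epsilon> * cos (p $ a) * cos (p $ b)) u v w"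
    unfolding curv_def D e osserman_tensor_def H
    using assms(2)
    by (simp add: Finite_Cartesian_Product.vec_eq_iff G \<alpha> axis_def \<beta>[of v u])
      (simp add: algebra_simps)
qed

text \<open>Apart from the square \<open>\<alpha>(v)\<^sup>2\<close> the form is diagonal. Its coefficients are \<open>cosh t + r sinh t\<close> with
  \<open>\<bar>r\<bar> \<le> 1\<close>, since the trigonometric factors are bounded and \<open>\<kappa>\<close> dominates \<open>\<epsilon>\<close>, and \<open>\<bar>sinh t\<bar> < cosh t\<close>.\<close>

lemma pos_def_osserman_form:
  fixes p :: "real^'m"
  assumes \<kappa>: "\<bar>\<epsilon>\<bar> \<le> \<kappa>" "0 < \<kappa>" and ab: "a \<noteq> b"
  shows "pos_def_form (osserman_form a b \<epsilon> \<kappa> p)"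
  unfolding pos_def_form_def
proof (intro conjI allI impI)
  show "bilinear (osserman_form a b \<epsilon> \<kappa> p)"
    unfolding bilinear_def
    by (auto intro!: linearI simp: osserman_form_def cosh_form_def sinh_form_linear algebra_simps
        sum.distrib sum_distrib_left add_divide_distrib)
  show "osserman_form a b \<epsilon> \<kappa> p u v = osserman_form a b \<epsilon> \<kappa> p v u" for u v
    by (simp add: osserman_form_def cosh_form_def mult.commute mult.left_commute)
  fix v :: "real^'m" assume "v \<noteq> 0"
  define r\<^sub>a r\<^sub>b
    where "r\<^sub>a = \<epsilon> * (cos (p $ a) * sin (p $ b)) / \<kappa>" and "r\<^sub>b = \<epsilon> * (sin (p $ a) * cos (p $ b)) / \<kappa>"
  define c where "c i = cosh (\<kappa> * p $ i) - (if i = a then r\<^sub>a * sinh (\<kappa> * p $ i) else 0)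
      + (if i = b then r\<^sub>b * sinh (\<kappa> * p $ i) else 0)" for i
  have less: "\<bar>r * sinh x\<bar> < cosh x" if "\<bar>r\<bar> \<le> 1" for r x :: real
  proof -
    have "\<bar>r * sinh x\<bar> \<le> 1 * \<bar>sinh x\<bar>" unfolding abs_mult using that by (intro mult_right_mono) auto
    also have "\<dots> < cosh x"
      using cosh_minus_sinh[of x] cosh_plus_sinh[of x] exp_gt_zero[of x] exp_gt_zero[of "-x"] by linarith
    finally show ?thesis .
  qed
  have bound: "\<bar>\<epsilon> * (s * t) / \<kappa>\<bar> \<le> 1" if "\<bar>s\<bar> \<le> 1" "\<bar>t\<bar> \<le> 1" for s t
  proof -
    have "\<bar>\<epsilon>\<bar> * (\<bar>s\<bar> * \<bar>t\<bar>) \<le> \<kappa> * (1 * 1)"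
      using that \<kappa> by (intro mult_mono) auto
    then show ?thesis using \<kappa> by (simp add: abs_mult)
  qed
  have "\<bar>r\<^sub>a\<bar> \<le> 1" "\<bar>r\<^sub>b\<bar> \<le> 1"
    unfolding r\<^sub>a_def r\<^sub>b_def by (rule bound; simp)+
  then have bd: "\<bar>r\<^sub>a * sinh t\<bar> < cosh t" "\<bar>r\<^sub>b * sinh t\<bar> < cosh t" for t
    by (auto intro: less)
  have "0 < c i" for i
  proof -
    consider "i = a" | "i = b" | "i \<noteq> a" "i \<noteq> b" by blast
    then show ?thesis
    proof cases
      case 1
      then show ?thesis using bd(1)[of "\<kappa> * p $ a"] ab by (simp add: c_def abs_less_iff)
    next
      case 2
      have "- (r\<^sub>b * sinh (\<kappa> * p $ b)) < cosh (\<kappa> * p $ b)"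
        using bd(2)[of "\<kappa> * p $ b"] by (simp add: abs_less_iff)
      with 2 ab show ?thesis by (simp add: c_def)
    qed (simp add: c_def)
  qed
  moreover obtain i where "v $ i \<noteq> 0"
    using \<open>v \<noteq> 0\<close> by (auto simp: Finite_Cartesian_Product.vec_eq_iff)
  ultimately have "0 < (\<Sum>i\<in>UNIV. c i * (v $ i)\<^sup>2)"
    by (intro sum_pos2[of _ i]) (auto simp: less_imp_le)
  also have "\<dots> = osserman_form a b \<epsilon> \<kappa> p v v - (sinh_form \<kappa> p v)\<^sup>2"
    by (simp add: c_def r\<^sub>a_def r\<^sub>b_def osserman_form_def cosh_form_def algebra_simps sum.distrib sum_subtractf power2_eq_square
        if_distrib[of "(*) _"] cong: if_cong)
  also have "\<dots> \<le> osserman_form a b \<epsilon> \<kappa> p v v" by simp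
  finally show "0 < osserman_form a b \<epsilon> \<kappa> p v v" .
qed

lemma osserman_form_0: "osserman_form a b \<epsilon> \<kappa> 0 = (\<bullet>)"
  by (intro ext) (simp add: osserman_form_def cosh_form_def sinh_form_def inner_vec_def)

section \<open>The model\<close>

lemma sum_model_component:
  fixes X Y Z :: "nat \<Rightarrow> real"
  assumes "2 \<le> N" "l \<in> {1..N}"
  shows "(\<Sum>i = 1..N. \<Sum>j = 1..N. \<Sum>k = 1..N. X i * Y j * Z k * model_component \<epsilon> i j k l)
    = X l * (\<Sum>j = 1..N. Y j * Z j) - Y l * (\<Sum>i = 1..N. X i * Z i)
      - \<epsilon> * (X 1 * Y 2 - X 2 * Y 1) * (if l = 1 \<or> l = 2 then Z l else 0)"
proof -
  define e where "e = (if l = 1 \<or> l = 2 then \<epsilon> else 0)"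
  \<comment> \<open>The condition on \<open>k\<close> comes first, so that the innermost sum collapses.\<close>
  have comp: "X i * Y j * Z k * model_component \<epsilon> i j k l
      = (if k = j then if i = l then X i * Y j * Z k else 0 else 0)
        - (if k = i then if j = l then X i * Y j * Z k else 0 else 0)
        - (if k = l then if j = 2 then if i = 1 then e * (X i * Y j * Z k) else 0 else 0 else 0)
        + (if k = l then if j = 1 then if i = 2 then e * (X i * Y j * Z k) else 0 else 0 else 0)" for i j k
    by (auto simp: model_component_def e_def)
  have T1: "(\<Sum>i = 1..N. \<Sum>j = 1..N. \<Sum>k = 1..N. if k = j then if i = l then X i * Y j * Z k else 0 else 0)
      = X l * (\<Sum>j = 1..N. Y j * Z j)"
  proof -
    have "(\<Sum>j = 1..N. \<Sum>k = 1..N. if k = j then if i = l then X i * Y j * Z k else 0 else 0)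
        = (if i = l then X l * (\<Sum>j = 1..N. Y j * Z j) else 0)" for i
      by (simp add: sum_distrib_left mult.assoc)
    then show ?thesis using assms by simp
  qed
  have T2: "(\<Sum>i = 1..N. \<Sum>j = 1..N. \<Sum>k = 1..N. if k = i then if j = l then X i * Y j * Z k else 0 else 0)
      = Y l * (\<Sum>i = 1..N. X i * Z i)"
    using assms by (simp add: sum_distrib_left mult_ac)
  have T3: "(\<Sum>i = 1..N. \<Sum>j = 1..N. \<Sum>k = 1..N. if k = l then if j = s then if i = r
        then e * (X i * Y j * Z k) else 0 else 0 else 0) = e * (X r * Y s * Z l)"
    if "r \<in> {1..N}" "s \<in> {1..N}" for r s
    using assms that by simp
  show ?thesis
    unfolding comp sum.distrib sum_subtractf T1 T2
    using assms by (simp add: T3) (simp add: e_def algebra_simps)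
qed

lemma model_curvature_eq_osserman_tensor:
  fixes idx :: "nat \<Rightarrow> 'm::finite"
  assumes dim: "CARD('m) \<ge> 2" and idx: "bij_betw idx {1..CARD('m)} UNIV"
  shows "model_curvature idx \<epsilon> = osserman_tensor (idx 1) (idx 2) (\<bullet>) \<epsilon>"
proof (intro ext)
  fix x y z :: "real^'m"
  have inj: "idx i = idx j \<longleftrightarrow> i = j" if "i \<in> {1..CARD('m)}" "j \<in> {1..CARD('m)}" for i j
    by (rule inj_on_eq_iff[OF bij_betw_imp_inj_on[OF idx] that])
  have inner: "u \<bullet> v = (\<Sum>i = 1..CARD('m). u $ idx i * v $ idx i)" for u v
    unfolding inner_vec_def using sum.reindex_bij_betw[OF idx, of "\<lambda>i. u $ i * v $ i"] by simp
  have "model_curvature idx \<epsilon> x y z $ i = osserman_tensor (idx 1) (idx 2) (\<bullet>) \<epsilon> x y z $ i" for i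
  proof -
    obtain l where l: "l \<in> {1..CARD('m)}" "i = idx l"
      using idx unfolding bij_betw_def by (metis UNIV_I imageE)
    have ax: "axis (idx k) (1::real) $ i = (if k = l then 1 else 0)" if "k \<in> {1..CARD('m)}" for k
      using that l inj by (auto simp: axis_def)
    have "model_curvature idx \<epsilon> x y z $ i = (\<Sum>i = 1..CARD('m). \<Sum>j = 1..CARD('m). \<Sum>k = 1..CARD('m).
        x $ idx i * y $ idx j * z $ idx k * model_component \<epsilon> i j k l)"
      using l(1) by (simp add: model_curvature_def basis_vector_def ax mult_delta_right)
    also have "\<dots> = osserman_tensor (idx 1) (idx 2) (\<bullet>) \<epsilon> x y z $ i"
      unfolding sum_model_component[OF dim l(1), of "\<lambda>i. x $ idx i" "\<lambda>i. y $ idx i" "\<lambda>i. z $ idx i"]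
      using dim l ax by (auto simp: osserman_tensor_def inner algebra_simps)
    finally show ?thesis .
  qed
  then show "model_curvature idx \<epsilon> x y z = osserman_tensor (idx 1) (idx 2) (\<bullet>) \<epsilon> x y z"
    by (simp add: Finite_Cartesian_Product.vec_eq_iff)
qed

theorem theorem1p11:
  fixes idx :: "nat \<Rightarrow> 'm::finite" and \<epsilon> :: real
  assumes "CARD('m) \<ge> 2"
    and "bij_betw idx {1..CARD('m)} UNIV"
  shows "affine_projective_Osserman_model UNIV (model_curvature idx \<epsilon>) \<and>
    (\<exists>(M :: (real ^ 'm) topology) (\<A> :: (real ^ 'm, real ^ 'm) chart set) D.
      affine_projective_Osserman_manifold M \<A> D \<and>
      geometrically_realizable_by UNIV (model_curvature idx \<epsilon>) M \<A> D)"
proof -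
  \<comment> \<open>Adding 1 keeps \<open>\<kappa>\<close> positive for \<open>\<epsilon> = 0\<close>.\<close>
  define \<kappa> where "\<kappa> = 1 + \<bar>\<epsilon>\<bar>"
  let ?a = "idx 1" and ?b = "idx 2"
  have \<kappa>: "\<bar>\<epsilon>\<bar> \<le> \<kappa>" "0 < \<kappa>" "\<kappa> \<noteq> 0" by (auto simp: \<kappa>_def)
  have ab: "?a \<noteq> ?b"
    using assms inj_onD[of idx "{1..CARD('m)}" 1 2] by (auto simp: bij_betw_def)
  interpret christoffel "osserman_symbols ?a ?b \<epsilon> \<kappa>" by (rule christoffel_osserman_symbols)
  note model = model_curvature_eq_osserman_tensor[OF assms]
  have "pos_def_form ((\<bullet>) :: real^'m \<Rightarrow> real^'m \<Rightarrow> real)"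
    using pos_def_osserman_form[OF \<kappa>(1,2) ab, of 0] by (simp add: osserman_form_0)
  then have "affine_projective_Osserman_model UNIV (model_curvature idx \<epsilon>)"
    unfolding model using ab assms(1) by (rule osserman_tensor_Osserman_model)
  moreover have "affine_projective_Osserman_manifold euclidean std_atlas conn"
    using curv_osserman_symbols[OF \<kappa>(3) ab] pos_def_osserman_form[OF \<kappa>(1,2) ab] ab assms(1) by (rule Osserman_manifold_of_osserman_tensor)
  moreover have "curv 0 = model_curvature idx \<epsilon>"
    unfolding model curv_osserman_symbols[OF \<kappa>(3) ab] by (simp add: osserman_form_0)
  then have "geometrically_realizable_by UNIV (model_curvature idx \<epsilon>) euclidean std_atlas conn"
    by (rule realizable_at)
  ultimately show ?thesis by blast
qed

end
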